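(* Let $(\mathfrak{g},\mathfrak{T})$ be a $\lambda$-weighted Rota-Baxter Lie algebra and let $(\mathcal{V},\mathcal{T})$ be a representation of it. Then there is a one-to-one correspondence between $\mathrm{Ext}(\mathfrak{g},\mathcal{V})$, the set of isomorphism classes of abelian extensions of $(\mathfrak{g},\mathfrak{T})$ by $(\mathcal{V},\mathcal{T})$ whose induced representation on $(\mathcal{V},\mathcal{T})$ is the given one, and the second cohomology group $H^2_{\mathsf{RB}}(\mathfrak{g},\mathcal{V})$ of $(\mathfrak{g},\mathfrak{T})$ with coefficients in $(\mathcal{V},\mathcal{T})$.
   Context: All vector spaces and (multi)linear maps are over a field $\mathbf{k}$ of characteristic $0$; $\lambda\in\mathbf{k}$ is a fixed scalar. **Rota-Baxter Lie algebras and representations.** A $\lambda$-weighted Rota-Baxter Lie algebra is a pair $(\mathfrak{g},\mathfrak{T})$ of a Lie algebra $\mathfrak{g}$ and a linear map $\mathfrak{T}:\mathfrak{g}\to\mathfrak{g}$ with $[\mathfrak{T}(x),\mathfrak{T}(y)]=\mathfrak{T}([\mathfrak{T}(x),y]+[x,\mathfrak{T}(y)]+\lambda[x,y])$ for all $x,y\in\mathfrak{g}$. A morphism $(\mathfrak{g},\mathfrak{T})\to(\mathfrak{g}',\mathfrak{T}')$ is a Lie algebra homomorphism $\phi$ with $\phi\circ\mathfrak{T}=\mathfrak{T}'\circ\phi$; it is an isomorphism if $\phi$ is bijective. A representation of $(\mathfrak{g},\mathfrak{T})$ is a pair $(\mathcal{V},\mathcal{T})$ where $\mathcal{V}=(\mathcal{V},\rho)$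 is a representation of the Lie algebra $\mathfrak{g}$ and $\mathcal{T}:\mathcal{V}\to\mathcal{V}$ is linear with $\rho(\mathfrak{T}x)(\mathcal{T}u)=\mathcal{T}(\rho(\mathfrak{T}x)u+\rho(x)(\mathcal{T}u)+\lambda\rho(x)u)$ for all $x\in\mathfrak{g}$, $u\in\mathcal{V}$. **Cohomology.** Put $[x,y]_{\mathfrak{T}}=[\mathfrak{T}(x),y]+[x,\mathfrak{T}(y)]+\lambda[x,y]$ and $\widetilde{\rho}(x)u=\rho(\mathfrak{T}(x))u-\mathcal{T}(\rho(x)u)$; then $\mathfrak{g}_{\mathfrak{T}}=(\mathfrak{g},[\,,]_{\mathfrak{T}})$ is a Lie algebra and $\widetilde{\mathcal{V}}=(\mathcal{V},\widetilde{\rho})$ is a representation of it. For $f\in\mathrm{Hom}(\wedge^n\mathfrak{g},\mathcal{V})$ let $$(\delta_{\mathsf{CE}}f)(x_1,\ldots,x_{n+1})=\sum_{i=1}^{n+1}(-1)^{i+n}\rho(x_i)f(x_1,\ldots,\widehat{x_i},\ldots,x_{n+1})+\sum_{1\le i<j\le n+1}(-1)^{i+j+n+1}f([x_i,x_j],x_1,\ldots,\widehat{x_i},\ldots,\widehat{x_j},\ldots,x_{n+1}),$$ and let $\partial_{\mathsf{CE}}$ be given by the same formula with $\rho$ replaced by $\widetilde{\rho}$ and $[\,,]$ replaced by $[\,,]_{\mathfrak{T}}$. Let $\Phi^0=\mathrm{id}_{\mathcal{V}}$ and, for $n\ge1$, $$\Phi^n(f)(x_1,\ldots,x_n)=f(\mathfrak{T}(x_1),\ldots,\mathfrak{T}(x_n))-\sum_{k=0}^{n-1}\lambda^{n-k-1}\sum_{i_1<\cdots<i_k}\mathcal{T}\big(f(x_1,\ldots,\mathfrak{T}(x_{i_1}),\ldots,\mathfrak{T}(x_{i_k}),\ldots,x_n)\big),$$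 where in the inner sum $\mathfrak{T}$ is applied exactly to the entries in positions $i_1,\ldots,i_k$. One has $\partial_{\mathsf{CE}}\circ\Phi^n=\Phi^{n+1}\circ\delta_{\mathsf{CE}}$. Set $C^0_{\mathsf{RB}}(\mathfrak{g},\mathcal{V})=\mathcal{V}$ and $C^n_{\mathsf{RB}}(\mathfrak{g},\mathcal{V})=\mathrm{Hom}(\wedge^n\mathfrak{g},\mathcal{V})\oplus\mathrm{Hom}(\wedge^{n-1}\mathfrak{g},\mathcal{V})$ for $n\ge1$, with $\delta_{\mathsf{RB}}(v)=(\delta_{\mathsf{CE}}(v),-v)$ and $\delta_{\mathsf{RB}}(f,g)=(\delta_{\mathsf{CE}}(f),-\partial_{\mathsf{CE}}(g)-\Phi^n(f))$. This is a cochain complex, and $H^n_{\mathsf{RB}}(\mathfrak{g},\mathcal{V})$ is its $n$-th cohomology. **Abelian extensions.** For a vector space $\mathcal{V}$ with a linear map $\mathcal{T}:\mathcal{V}\to\mathcal{V}$, regard $(\mathcal{V},\mathcal{T})$ as a $\lambda$-weighted Rota-Baxter Lie algebra with zero bracket. An abelian extension of $(\mathfrak{g},\mathfrak{T})$ by $(\mathcal{V},\mathcal{T})$ is a short exact sequence of morphisms of $\lambda$-weighted Rota-Baxter Lie algebras $0\to(\mathcal{V},\mathcal{T})\xrightarrow{i}(\widehat{\mathfrak{g}},\widehat{\mathfrak{T}})\xrightarrow{p}(\mathfrak{g},\mathfrak{T})\to0$. Two abelian extensions $(\widehat{\mathfrak{g}},\widehat{\mathfrak{T}})$ (with maps $i,p$)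 and $(\widehat{\mathfrak{g}}',\widehat{\mathfrak{T}}')$ (with maps $i',p'$) are isomorphic if there is an isomorphism $\phi:(\widehat{\mathfrak{g}},\widehat{\mathfrak{T}})\to(\widehat{\mathfrak{g}}',\widehat{\mathfrak{T}}')$ of $\lambda$-weighted Rota-Baxter Lie algebras with $\phi\circ i=i'$ and $p'\circ\phi=p$. Given an abelian extension and a linear section $s:\mathfrak{g}\to\widehat{\mathfrak{g}}$ of $p$ (i.e. $p\circ s=\mathrm{id}_{\mathfrak{g}}$), the induced representation on $(\mathcal{V},\mathcal{T})$ is the one with action $\rho(x)(u)=[s(x),i(u)]_{\widehat{\mathfrak{g}}}$ (an element of $i(\mathcal{V})\cong\mathcal{V}$); it is a representation of $(\mathfrak{g},\mathfrak{T})$ and is independent of $s$. *)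

theory Defs
  imports "HOL-Algebra.Module" "HOL-Algebra.Coset" "HOL-Algebra.Elementary_Groups"
begin

section \<open>Rota-Baxter Lie algebras and their representations\<close>

text \<open>As everywhere in HOL-Algebra, operations are only meaningful on carriers.  The fields
  \<open>mult\<close> and \<open>one\<close> that \<open>module\<close> inherits from \<open>ring\<close> are never used.\<close>

record ('k, 'a) lie_alg = "('k, 'a) module" +
  bracket :: "'a \<Rightarrow> 'a \<Rightarrow> 'a"

locale field_char_zero = field K for K (structure) +
  assumes char_zero: "(n::nat) > 0 \<Longrightarrow> [n] \<cdot> \<one> \<noteq> \<zero>"

definition linear_mod ::
  "('k, 'm) ring_scheme \<Rightarrow> ('k, 'a, 'n) module_scheme \<Rightarrow> ('k, 'b, 'p) module_scheme
     \<Rightarrow> ('a \<Rightarrow> 'b) \<Rightarrow> bool" where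
  "linear_mod K M N f \<longleftrightarrow>
     f \<in> carrier M \<rightarrow> carrier N \<and>
     (\<forall>x\<in>carrier M. \<forall>y\<in>carrier M. f (x \<oplus>\<^bsub>M\<^esub> y) = f x \<oplus>\<^bsub>N\<^esub> f y) \<and>
     (\<forall>a\<in>carrier K. \<forall>x\<in>carrier M. f (a \<odot>\<^bsub>M\<^esub> x) = a \<odot>\<^bsub>N\<^esub> f x)"

locale lie_algebra = field K + module K L for K (structure) and L (structure) +
  assumes bracket_linear_left: "y \<in> carrier L \<Longrightarrow> linear_mod K L L (\<lambda>x. bracket L x y)"
    and bracket_linear_right: "x \<in> carrier L \<Longrightarrow> linear_mod K L L (bracket L x)"
    and bracket_alternating: "x \<in> carrier L \<Longrightarrow> bracket L x x = \<zero>\<^bsub>L\<^esub>"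
    and jacobi: "\<lbrakk>x \<in> carrier L; y \<in> carrier L; z \<in> carrier L\<rbrakk> \<Longrightarrow>
      bracket L x (bracket L y z) \<oplus>\<^bsub>L\<^esub> bracket L y (bracket L z x)
        \<oplus>\<^bsub>L\<^esub> bracket L z (bracket L x y) = \<zero>\<^bsub>L\<^esub>"

text \<open>The bracket \<open>[T x, y] + [x, T y] + \<lambda> [x, y]\<close>, and the algebra carrying it.\<close>

definition deformed_bracket ::
  "'k \<Rightarrow> ('k, 'a, 'n) lie_alg_scheme \<Rightarrow> ('a \<Rightarrow> 'a) \<Rightarrow> 'a \<Rightarrow> 'a \<Rightarrow> 'a" where
  "deformed_bracket lam L T x y =
     bracket L (T x) y \<oplus>\<^bsub>L\<^esub> bracket L x (T y) \<oplus>\<^bsub>L\<^esub> lam \<odot>\<^bsub>L\<^esub> bracket L x y"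

definition deformed ::
  "'k \<Rightarrow> ('k, 'a, 'n) lie_alg_scheme \<Rightarrow> ('a \<Rightarrow> 'a) \<Rightarrow> ('k, 'a, 'n) lie_alg_scheme" where
  "deformed lam L T = L\<lparr>bracket := deformed_bracket lam L T\<rparr>"

locale rota_baxter_lie = lie_algebra K L for K (structure) and lam and L (structure) and T +
  assumes weight_closed: "lam \<in> carrier K"
    and op_linear: "linear_mod K L L T"
    and rota_baxter: "\<lbrakk>x \<in> carrier L; y \<in> carrier L\<rbrakk> \<Longrightarrow>
      bracket L (T x) (T y) = T (deformed_bracket lam L T x y)"

definition rb_morphism ::
  "('k, 'm) ring_scheme \<Rightarrow> ('k, 'a, 'n) lie_alg_scheme \<Rightarrow> ('a \<Rightarrow> 'a)
     \<Rightarrow> ('k, 'b, 'p) lie_alg_scheme \<Rightarrow> ('b \<Rightarrow> 'b) \<Rightarrow> ('a \<Rightarrow> 'b) \<Rightarrow> bool" where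
  "rb_morphism K L T L' T' f \<longleftrightarrow>
     linear_mod K L L' f \<and>
     (\<forall>x\<in>carrier L. \<forall>y\<in>carrier L. f (bracket L x y) = bracket L' (f x) (f y)) \<and>
     (\<forall>x\<in>carrier L. f (T x) = T' (f x))"

definition rb_isomorphism ::
  "('k, 'm) ring_scheme \<Rightarrow> ('k, 'a, 'n) lie_alg_scheme \<Rightarrow> ('a \<Rightarrow> 'a)
     \<Rightarrow> ('k, 'b, 'p) lie_alg_scheme \<Rightarrow> ('b \<Rightarrow> 'b) \<Rightarrow> ('a \<Rightarrow> 'b) \<Rightarrow> bool" where
  "rb_isomorphism K L T L' T' f \<longleftrightarrow>
     rb_morphism K L T L' T' f \<and> bij_betw f (carrier L) (carrier L')"

locale lie_representation = lie_algebra K L + V: module K V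
  for K (structure) and L (structure) and V (structure) and \<rho> +
  assumes action_linear: "x \<in> carrier L \<Longrightarrow> linear_mod K V V (\<rho> x)"
    and action_linear_left: "u \<in> carrier V \<Longrightarrow> linear_mod K L V (\<lambda>x. \<rho> x u)"
    and action_bracket: "\<lbrakk>x \<in> carrier L; y \<in> carrier L; u \<in> carrier V\<rbrakk> \<Longrightarrow>
      \<rho> (bracket L x y) u = \<rho> x (\<rho> y u) \<ominus>\<^bsub>V\<^esub> \<rho> y (\<rho> x u)"

locale rb_representation = rota_baxter_lie K lam L T + lie_representation K L V \<rho>
  for K (structure) and lam and L (structure) and T and V (structure) and \<rho> and S +
  assumes rep_op_linear: "linear_mod K V V S"
    and rep_rota_baxter: "\<lbrakk>x \<in> carrier L; u \<in> carrier V\<rbrakk> \<Longrightarrow>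
      \<rho> (T x) (S u) =
        S (\<rho> (T x) u \<oplus>\<^bsub>V\<^esub> \<rho> x (S u) \<oplus>\<^bsub>V\<^esub> lam \<odot>\<^bsub>V\<^esub> \<rho> x u)"

definition deformed_action ::
  "('a \<Rightarrow> 'a) \<Rightarrow> ('k, 'v, 'n) module_scheme \<Rightarrow> ('a \<Rightarrow> 'v \<Rightarrow> 'v) \<Rightarrow> ('v \<Rightarrow> 'v)
     \<Rightarrow> 'a \<Rightarrow> 'v \<Rightarrow> 'v" where
  "deformed_action T V \<rho> S x u = \<rho> (T x) u \<ominus>\<^bsub>V\<^esub> S (\<rho> x u)"


section \<open>Cochains\<close>

text \<open>An element of \<open>Hom(\<And>\<^sup>n L, V)\<close> is an alternating multilinear map on tuples, which are lists
  of length \<open>n\<close>.  It is extensional (\<open>undefined\<close> off the tuples), so that equality of cochains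
  is equality of functions.\<close>

definition tuples :: "('a, 'm) partial_object_scheme \<Rightarrow> nat \<Rightarrow> 'a list set" where
  "tuples L n = {xs. length xs = n \<and> set xs \<subseteq> carrier L}"

definition alt_maps ::
  "('k, 'm) ring_scheme \<Rightarrow> ('k, 'a, 'n) module_scheme \<Rightarrow> ('k, 'v, 'p) module_scheme \<Rightarrow> nat
     \<Rightarrow> ('a list \<Rightarrow> 'v) set" where
  "alt_maps K L V n =
     {f \<in> tuples L n \<rightarrow>\<^sub>E carrier V.
        (\<forall>xs\<in>tuples L n. \<forall>i<n. linear_mod K L V (\<lambda>x. f (xs[i := x]))) \<and>
        (\<forall>xs\<in>tuples L n. \<forall>i<n. \<forall>j<n. i \<noteq> j \<longrightarrow> xs ! i = xs ! j \<longrightarrow> f xs = \<zero>\<^bsub>V\<^esub>)}"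

definition alt_group ::
  "('k, 'm) ring_scheme \<Rightarrow> ('k, 'a, 'n) module_scheme \<Rightarrow> ('k, 'v, 'p) module_scheme \<Rightarrow> nat
     \<Rightarrow> ('a list \<Rightarrow> 'v) monoid" where
  "alt_group K L V n =
     \<lparr>carrier = alt_maps K L V n,
      monoid.mult = (\<lambda>f g. \<lambda>xs\<in>tuples L n. f xs \<oplus>\<^bsub>V\<^esub> g xs),
      one = (\<lambda>xs\<in>tuples L n. \<zero>\<^bsub>V\<^esub>)\<rparr>"

text \<open>Positions are counted from 1 in \<open>entry\<close>, \<open>omit\<close> and \<open>apply_at\<close>, as in the usual formulas.\<close>

definition entry :: "'a list \<Rightarrow> nat \<Rightarrow> 'a" where
  "entry xs i = xs ! (i - 1)"

definition omit :: "nat \<Rightarrow> 'a list \<Rightarrow> 'a list" where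
  "omit i xs = take (i - 1) xs @ drop i xs"

definition apply_at :: "('a \<Rightarrow> 'a) \<Rightarrow> nat set \<Rightarrow> 'a list \<Rightarrow> 'a list" where
  "apply_at T I xs =
     map (\<lambda>i. if i \<in> I then T (entry xs i) else entry xs i) [1..<Suc (length xs)]"

definition sign :: "('k, 'm) ring_scheme \<Rightarrow> nat \<Rightarrow> 'k" where
  "sign K m = (\<ominus>\<^bsub>K\<^esub> \<one>\<^bsub>K\<^esub>) [^]\<^bsub>K\<^esub> m"

text \<open>In the second sum \<open>i < j\<close>, so position \<open>j\<close> has to be omitted before position \<open>i\<close>.\<close>

definition ce_diff ::
  "('k, 'm) ring_scheme \<Rightarrow> ('k, 'a, 'n) lie_alg_scheme \<Rightarrow> ('k, 'v, 'p) module_scheme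
     \<Rightarrow> ('a \<Rightarrow> 'v \<Rightarrow> 'v) \<Rightarrow> nat \<Rightarrow> ('a list \<Rightarrow> 'v) \<Rightarrow> 'a list \<Rightarrow> 'v" where
  "ce_diff K L V \<rho> n f = (\<lambda>xs\<in>tuples L (n + 1).
     (\<Oplus>\<^bsub>V\<^esub>i\<in>{1..n + 1}. sign K (i + n) \<odot>\<^bsub>V\<^esub> \<rho> (entry xs i) (f (omit i xs)))
     \<oplus>\<^bsub>V\<^esub>
     (\<Oplus>\<^bsub>V\<^esub>ij\<in>{(i, j). 1 \<le> i \<and> i < j \<and> j \<le> n + 1}. case ij of (i, j) \<Rightarrow>
        sign K (i + j + n + 1) \<odot>\<^bsub>V\<^esub>
          f (bracket L (entry xs i) (entry xs j) # omit i (omit j xs))))"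

text \<open>For \<open>n = 0\<close> the sum is empty and \<open>rb_phi\<close> is the identity.\<close>

definition rb_phi ::
  "('k, 'm) ring_scheme \<Rightarrow> 'k \<Rightarrow> ('k, 'a, 'n) lie_alg_scheme \<Rightarrow> ('a \<Rightarrow> 'a)
     \<Rightarrow> ('k, 'v, 'p) module_scheme \<Rightarrow> ('v \<Rightarrow> 'v) \<Rightarrow> nat \<Rightarrow> ('a list \<Rightarrow> 'v) \<Rightarrow> 'a list \<Rightarrow> 'v" where
  "rb_phi K lam L T V S n f = (\<lambda>xs\<in>tuples L n.
     f (map T xs) \<ominus>\<^bsub>V\<^esub>
     (\<Oplus>\<^bsub>V\<^esub>k\<in>{0..<n}. (lam [^]\<^bsub>K\<^esub> (n - k - 1)) \<odot>\<^bsub>V\<^esub>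
        (\<Oplus>\<^bsub>V\<^esub>I\<in>{I. I \<subseteq> {1..n} \<and> card I = k}. S (f (apply_at T I xs)))))"


section \<open>The Rota-Baxter complex\<close>

text \<open>\<open>C\<^sup>0 = V\<close> is encoded as \<open>Hom(\<And>\<^sup>0 L, V) \<oplus> 0\<close>, so that cochains of all degrees have the same
  type; \<open>v\<close> corresponds to the map sending the empty tuple to \<open>v\<close>.\<close>

definition rb_cochains ::
  "('k, 'm) ring_scheme \<Rightarrow> ('k, 'a, 'n) module_scheme \<Rightarrow> ('k, 'v, 'p) module_scheme \<Rightarrow> nat
     \<Rightarrow> (('a list \<Rightarrow> 'v) \<times> ('a list \<Rightarrow> 'v)) monoid" where
  "rb_cochains K L V n = (case n of
       0 \<Rightarrow> alt_group K L V 0 \<times>\<times> singleton_group (\<lambda>_. undefined)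
     | Suc m \<Rightarrow> alt_group K L V (Suc m) \<times>\<times> alt_group K L V m)"

fun rb_diff ::
  "('k, 'm) ring_scheme \<Rightarrow> 'k \<Rightarrow> ('k, 'a, 'n) lie_alg_scheme \<Rightarrow> ('a \<Rightarrow> 'a)
     \<Rightarrow> ('k, 'v, 'p) module_scheme \<Rightarrow> ('a \<Rightarrow> 'v \<Rightarrow> 'v) \<Rightarrow> ('v \<Rightarrow> 'v) \<Rightarrow> nat
     \<Rightarrow> ('a list \<Rightarrow> 'v) \<times> ('a list \<Rightarrow> 'v) \<Rightarrow> ('a list \<Rightarrow> 'v) \<times> ('a list \<Rightarrow> 'v)" where
  "rb_diff K lam L T V \<rho> S 0 (f, g) =
     (ce_diff K L V \<rho> 0 f, \<lambda>xs\<in>tuples L 0. \<ominus>\<^bsub>V\<^esub> f xs)"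
| "rb_diff K lam L T V \<rho> S (Suc m) (f, g) =
     (ce_diff K L V \<rho> (Suc m) f,
      \<lambda>xs\<in>tuples L (Suc m).
        \<ominus>\<^bsub>V\<^esub> ce_diff K (deformed lam L T) V (deformed_action T V \<rho> S) m g xs
        \<ominus>\<^bsub>V\<^esub> rb_phi K lam L T V S (Suc m) f xs)"

definition rb_cocycles ::
  "('k, 'm) ring_scheme \<Rightarrow> 'k \<Rightarrow> ('k, 'a, 'n) lie_alg_scheme \<Rightarrow> ('a \<Rightarrow> 'a)
     \<Rightarrow> ('k, 'v, 'p) module_scheme \<Rightarrow> ('a \<Rightarrow> 'v \<Rightarrow> 'v) \<Rightarrow> ('v \<Rightarrow> 'v) \<Rightarrow> nat
     \<Rightarrow> (('a list \<Rightarrow> 'v) \<times> ('a list \<Rightarrow> 'v)) set" where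
  "rb_cocycles K lam L T V \<rho> S n =
     kernel (rb_cochains K L V n) (rb_cochains K L V (Suc n)) (rb_diff K lam L T V \<rho> S n)"

definition rb_coboundaries ::
  "('k, 'm) ring_scheme \<Rightarrow> 'k \<Rightarrow> ('k, 'a, 'n) lie_alg_scheme \<Rightarrow> ('a \<Rightarrow> 'a)
     \<Rightarrow> ('k, 'v, 'p) module_scheme \<Rightarrow> ('a \<Rightarrow> 'v \<Rightarrow> 'v) \<Rightarrow> ('v \<Rightarrow> 'v) \<Rightarrow> nat
     \<Rightarrow> (('a list \<Rightarrow> 'v) \<times> ('a list \<Rightarrow> 'v)) set" where
  "rb_coboundaries K lam L T V \<rho> S n = (case n of
       0 \<Rightarrow> {\<one>\<^bsub>rb_cochains K L V 0\<^esub>}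
     | Suc m \<Rightarrow> rb_diff K lam L T V \<rho> S m ` carrier (rb_cochains K L V m))"

definition rb_cohomology ::
  "('k, 'm) ring_scheme \<Rightarrow> 'k \<Rightarrow> ('k, 'a, 'n) lie_alg_scheme \<Rightarrow> ('a \<Rightarrow> 'a)
     \<Rightarrow> ('k, 'v, 'p) module_scheme \<Rightarrow> ('a \<Rightarrow> 'v \<Rightarrow> 'v) \<Rightarrow> ('v \<Rightarrow> 'v) \<Rightarrow> nat
     \<Rightarrow> (('a list \<Rightarrow> 'v) \<times> ('a list \<Rightarrow> 'v)) set monoid" where
  "rb_cohomology K lam L T V \<rho> S n =
     (rb_cochains K L V n)\<lparr>carrier := rb_cocycles K lam L T V \<rho> S n\<rparr>
       Mod rb_coboundaries K lam L T V \<rho> S n"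


section \<open>Abelian extensions\<close>

definition abelian_lie :: "('k, 'v, 'p) module_scheme \<Rightarrow> ('k, 'v) lie_alg" where
  "abelian_lie V =
     \<lparr>carrier = carrier V, monoid.mult = monoid.mult V, one = one V, zero = zero V, add = add V,
      smult = smult V, bracket = (\<lambda>_ _. \<zero>\<^bsub>V\<^esub>)\<rparr>"

text \<open>The carrier and all the operations of the middle algebra are part of the data of an
  extension; only the type \<open>'e\<close> its elements live in is fixed.\<close>

record ('k, 'a, 'v, 'e) extension =
  mid :: "('k, 'e) lie_alg"
  mid_op :: "'e \<Rightarrow> 'e"
  inclusion :: "'v \<Rightarrow> 'e"
  projection :: "'e \<Rightarrow> 'a"

definition abelian_extension ::
  "('k, 'm) ring_scheme \<Rightarrow> 'k \<Rightarrow> ('k, 'a, 'n) lie_alg_scheme \<Rightarrow> ('a \<Rightarrow> 'a)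
     \<Rightarrow> ('k, 'v, 'p) module_scheme \<Rightarrow> ('v \<Rightarrow> 'v) \<Rightarrow> ('k, 'a, 'v, 'e) extension \<Rightarrow> bool" where
  "abelian_extension K lam L T V S E \<longleftrightarrow>
     rota_baxter_lie K lam (mid E) (mid_op E) \<and>
     rb_morphism K (abelian_lie V) S (mid E) (mid_op E) (inclusion E) \<and>
     rb_morphism K (mid E) (mid_op E) L T (projection E) \<and>
     inj_on (inclusion E) (carrier V) \<and>
     inclusion E ` carrier V = {e \<in> carrier (mid E). projection E e = \<zero>\<^bsub>L\<^esub>} \<and>
     projection E ` carrier (mid E) = carrier L"

definition linear_section ::
  "('k, 'm) ring_scheme \<Rightarrow> ('k, 'a, 'n) lie_alg_scheme \<Rightarrow> ('k, 'a, 'v, 'e) extension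
     \<Rightarrow> ('a \<Rightarrow> 'e) \<Rightarrow> bool" where
  "linear_section K L E s \<longleftrightarrow>
     linear_mod K L (mid E) s \<and> (\<forall>x\<in>carrier L. projection E (s x) = x)"

definition induced_action ::
  "('k, 'v, 'p) module_scheme \<Rightarrow> ('k, 'a, 'v, 'e) extension \<Rightarrow> ('a \<Rightarrow> 'e) \<Rightarrow> 'a \<Rightarrow> 'v \<Rightarrow> 'v" where
  "induced_action V E s x u =
     inv_into (carrier V) (inclusion E) (bracket (mid E) (s x) (inclusion E u))"

text \<open>The induced action does not depend on the section, and over a field linear sections always
  exist, so quantifying over all sections is the same as choosing one.\<close>

definition extensions_inducing ::
  "('k, 'm) ring_scheme \<Rightarrow> 'k \<Rightarrow> ('k, 'a, 'n) lie_alg_scheme \<Rightarrow> ('a \<Rightarrow> 'a)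
     \<Rightarrow> ('k, 'v, 'p) module_scheme \<Rightarrow> ('a \<Rightarrow> 'v \<Rightarrow> 'v) \<Rightarrow> ('v \<Rightarrow> 'v)
     \<Rightarrow> ('k, 'a, 'v, 'e) extension set" where
  "extensions_inducing K lam L T V \<rho> S =
     {E. abelian_extension K lam L T V S E \<and>
         (\<forall>s. linear_section K L E s \<longrightarrow>
            (\<forall>x\<in>carrier L. \<forall>u\<in>carrier V. induced_action V E s x u = \<rho> x u))}"

definition extension_iso ::
  "('k, 'm) ring_scheme \<Rightarrow> ('k, 'v, 'p) module_scheme
     \<Rightarrow> ('k, 'a, 'v, 'e) extension \<Rightarrow> ('k, 'a, 'v, 'e) extension \<Rightarrow> bool" where
  "extension_iso K V E E' \<longleftrightarrow>
     (\<exists>\<phi>. rb_isomorphism K (mid E) (mid_op E) (mid E') (mid_op E') \<phi> \<and>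
          (\<forall>u\<in>carrier V. \<phi> (inclusion E u) = inclusion E' u) \<and>
          (\<forall>e\<in>carrier (mid E). projection E' (\<phi> e) = projection E e))"

text \<open>The set of isomorphism classes of extensions whose elements live in the type \<open>'e\<close>.  It
  represents all extensions as soon as \<open>carrier L \<times> carrier V\<close> injects into \<open>'e\<close> (for instance
  for \<open>'e = 'a \<times> 'v\<close>): the middle term of any extension is in bijection with that product.\<close>

definition Ext ::
  "('k, 'm) ring_scheme \<Rightarrow> 'k \<Rightarrow> ('k, 'a, 'n) lie_alg_scheme \<Rightarrow> ('a \<Rightarrow> 'a)
     \<Rightarrow> ('k, 'v, 'p) module_scheme \<Rightarrow> ('a \<Rightarrow> 'v \<Rightarrow> 'v) \<Rightarrow> ('v \<Rightarrow> 'v)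
     \<Rightarrow> ('k, 'a, 'v, 'e) extension set set" where
  "Ext K lam L T V \<rho> S =
     extensions_inducing K lam L T V \<rho> S //
       {(E, E'). E \<in> extensions_inducing K lam L T V \<rho> S \<and>
                 E' \<in> extensions_inducing K lam L T V \<rho> S \<and> extension_iso K V E E'}"

end

theory Submission
  imports Defs "HOL-Library.Poly_Mapping"
begin

text \<open>
  Choose a linear section \<open>s\<close> of the projection of an abelian extension.  As a vector space the middle
  algebra is then \<open>L \<oplus> V\<close>, and the only part of its structure that the data \<open>(L, T)\<close>, \<open>(V, S)\<close> and \<open>\<rho>\<close>
  do not determine is the failure of \<open>s\<close> to be a morphism: the \<open>V\<close>-valued maps
  \<open>F x y = [s x, s y] - s [x, y]\<close> and \<open>G x = T' (s x) - s (T x)\<close>, where \<open>T'\<close> is the operator of the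
  middle algebra.  In these coordinates
  \<open>[(x, u), (y, v)] = ([x, y], F x y + \<rho> x v - \<rho> y u)\<close> and \<open>T' (x, u) = (T x, G x + S u)\<close>.
  The bracket is alternating and bilinear, and \<open>T'\<close> is linear, exactly when \<open>F\<close> and \<open>G\<close> are such; the
  \<open>V\<close>-component of the Jacobi identity is the equation saying that the Chevalley-Eilenberg
  differential kills \<open>F\<close>; and the \<open>V\<close>-component of the Rota-Baxter identity is the second cocycle equation.
  So \<open>(F, G)\<close> is a 2-cocycle (\<open>defects_cocycle\<close>), and every 2-cocycle arises in this way from the algebra
  that the two formulas define (\<open>extension_of_cocycle\<close>).

  Another section has the form \<open>s + i \<circ> h\<close>, with \<open>i\<close> the inclusion of \<open>V\<close> and \<open>h\<close> a linear map from \<open>L\<close>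
  to \<open>V\<close>, and passing to it adds to
  \<open>(F, G)\<close> the coboundary of \<open>h\<close> (\<open>shifted_section\<close>).  The coboundaries of pairs \<open>(f, v)\<close> with \<open>v\<close> in \<open>V\<close>
  are no more general, because \<open>v\<close> can be absorbed into \<open>h x = f x - \<rho> x v\<close> (\<open>coboundaries_eq\<close>).
  An isomorphism of extensions carries a section to a section with the same defects, and two extensions
  having sections with the same defects are isomorphic.  Hence extensions are isomorphic exactly when
  their cocycles are cohomologous (\<open>extension_iso_iff_cohomologous\<close>), and the class of \<open>(F, G)\<close> classifies.
\<close>

section \<open>Identities in abelian groups\<close>

text \<open>An identity between signed sums in an abelian group holds as soon as it holds formally, that is, as
  soon as both sides have the same integer coefficients.  Formal sums are finitely supported integer-valued
  functions; they form an abelian group type, so the simplifier decides equality of coefficients there.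
  The rules \<open>represents_intros\<close> translate a term built from \<open>\<oplus>\<close>, \<open>\<ominus>\<close> and \<open>\<zero>\<close> into a formal sum, taking
  every other subterm as a generator.\<close>

context abelian_group
begin

text \<open>Generators outside the carrier are ignored, which makes evaluation additive on all formal sums.\<close>

definition combination :: "('a \<Rightarrow>\<^sub>0 int) \<Rightarrow> 'a" where
  "combination p =
     (\<Oplus>x\<in>Poly_Mapping.keys p \<inter> carrier G. [Poly_Mapping.lookup p x] \<cdot> x)"

lemma combination_superset:
  assumes "finite A" "Poly_Mapping.keys p \<inter> carrier G \<subseteq> A" "A \<subseteq> carrier G"
  shows "combination p = (\<Oplus>x\<in>A. [Poly_Mapping.lookup p x] \<cdot> x)"
  unfolding combination_def
proof (rule add.finprod_mono_neutral_cong_left)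
  show "\<And>x. x \<in> A - Poly_Mapping.keys p \<inter> carrier G \<Longrightarrow> [Poly_Mapping.lookup p x] \<cdot> x = \<zero>"
    using assms(3) by (auto simp: in_keys_iff add_pow_def)
qed (use assms in auto)

lemma combination_add: "combination (p + q) = combination p \<oplus> combination q"
proof -
  let ?A = "(Poly_Mapping.keys p \<union> Poly_Mapping.keys q) \<inter> carrier G"
  have *: "combination r = (\<Oplus>x\<in>?A. [Poly_Mapping.lookup r x] \<cdot> x)"
    if "Poly_Mapping.keys r \<subseteq> Poly_Mapping.keys p \<union> Poly_Mapping.keys q" for r
    using that by (intro combination_superset) auto
  have "combination (p + q)
      = (\<Oplus>x\<in>?A. [Poly_Mapping.lookup p x] \<cdot> x \<oplus> [Poly_Mapping.lookup q x] \<cdot> x)"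
    unfolding *[OF keys_add]
    by (intro finsum_cong') (auto simp: lookup_add add.int_pow_mult)
  also have "\<dots> = combination p \<oplus> combination q"
    by (subst finsum_addf) (auto simp: *)
  finally show ?thesis .
qed

definition represents :: "('a \<Rightarrow>\<^sub>0 int) \<Rightarrow> 'a \<Rightarrow> bool" where
  "represents p x \<longleftrightarrow> combination p = x"

lemma combination_closed: "combination p \<in> carrier G"
  by (auto simp: combination_def intro!: finsum_closed)

lemma represents_zero: "represents 0 \<zero>"
  by (simp add: represents_def combination_def)

lemma represents_element: "x \<in> carrier G \<Longrightarrow> represents (Poly_Mapping.single x 1) x"
  by (simp add: represents_def combination_def add.finprod_singleton_swap)

lemma represents_add: "represents p x \<Longrightarrow> represents q y \<Longrightarrow> represents (p + q) (x \<oplus> y)"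
  by (simp add: represents_def combination_add)

lemma represents_neg: "represents p x \<Longrightarrow> represents (- p) (\<ominus> x)"
proof -
  have "combination (- p) \<oplus> combination p = \<zero>"
    using combination_add[of "- p" p] represents_zero by (simp add: represents_def)
  then have "\<ominus> combination p = combination (- p)"
    by (intro minus_equality combination_closed)
  then show "represents p x \<Longrightarrow> represents (- p) (\<ominus> x)"
    by (simp add: represents_def)
qed

lemma represents_minus: "represents p x \<Longrightarrow> represents q y \<Longrightarrow> represents (p - q) (x \<ominus> y)"
  using represents_add[OF _ represents_neg, of p x q y] by (simp add: minus_eq)

text \<open>The rule for generators matches every term and therefore comes last.\<close>

lemmas represents_intros = represents_zero represents_add represents_minus represents_neg represents_element

text \<open>Applied backwards, the first two premises compute the formal sums \<open>p\<close> and \<open>q\<close> by unification, and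
  only a formal identity remains.\<close>

lemma eq_if_same_coefficients:
  assumes "represents p x" "represents q y" "p = q"
  shows "x = y"
  using assms by (simp add: represents_def)

end

lemma (in abelian_group) minus_eq_zero_iff:
  assumes "x \<in> carrier G" "y \<in> carrier G"
  shows "x \<ominus> y = \<zero> \<longleftrightarrow> x = y"
proof
  assume "x \<ominus> y = \<zero>"
  moreover have "x = x \<ominus> y \<oplus> y"
    by (rule eq_if_same_coefficients, (rule represents_intros | simp add: assms)+)
  ultimately show "x = y"
    using assms by (metis l_zero)
qed (use assms in \<open>simp add: minus_eq r_neg\<close>)

section \<open>Linear maps\<close>

lemma (in module) smult_minus_distr:
  "a \<in> carrier R \<Longrightarrow> x \<in> carrier M \<Longrightarrow> y \<in> carrier M \<Longrightarrow>
    a \<odot>\<^bsub>M\<^esub> (x \<ominus>\<^bsub>M\<^esub> y) = a \<odot>\<^bsub>M\<^esub> x \<ominus>\<^bsub>M\<^esub> a \<odot>\<^bsub>M\<^esub> y"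
  by (simp add: M.minus_eq smult_r_distr smult_r_minus)

lemma linear_mod_closed: "linear_mod K M N f \<Longrightarrow> x \<in> carrier M \<Longrightarrow> f x \<in> carrier N"
  by (auto simp: linear_mod_def)

lemma linear_mod_add:
  "linear_mod K M N f \<Longrightarrow> x \<in> carrier M \<Longrightarrow> y \<in> carrier M \<Longrightarrow> f (x \<oplus>\<^bsub>M\<^esub> y) = f x \<oplus>\<^bsub>N\<^esub> f y"
  by (auto simp: linear_mod_def)

lemma linear_mod_smult:
  "linear_mod K M N f \<Longrightarrow> a \<in> carrier K \<Longrightarrow> x \<in> carrier M \<Longrightarrow> f (a \<odot>\<^bsub>M\<^esub> x) = a \<odot>\<^bsub>N\<^esub> f x"
  by (auto simp: linear_mod_def)

lemma linear_mod_zero: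
  assumes "module K M" "module K N" "linear_mod K M N f"
  shows "f \<zero>\<^bsub>M\<^esub> = \<zero>\<^bsub>N\<^esub>"
proof -
  interpret M: module K M by fact
  interpret N: module K N by fact
  have "f (\<zero>\<^bsub>K\<^esub> \<odot>\<^bsub>M\<^esub> \<zero>\<^bsub>M\<^esub>) = \<zero>\<^bsub>K\<^esub> \<odot>\<^bsub>N\<^esub> f \<zero>\<^bsub>M\<^esub>"
    by (intro linear_mod_smult[OF assms(3)]) auto
  then show ?thesis
    using linear_mod_closed[OF assms(3), of "\<zero>\<^bsub>M\<^esub>"] by simp
qed

lemma linear_mod_neg:
  assumes "module K M" "module K N" "linear_mod K M N f" "x \<in> carrier M"
  shows "f (\<ominus>\<^bsub>M\<^esub> x) = \<ominus>\<^bsub>N\<^esub> f x"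
proof -
  interpret M: module K M by fact
  interpret N: module K N by fact
  have "f (\<ominus>\<^bsub>M\<^esub> x) \<oplus>\<^bsub>N\<^esub> f x = \<zero>\<^bsub>N\<^esub>"
    using linear_mod_add[OF assms(3), of "\<ominus>\<^bsub>M\<^esub> x" x] assms(4) linear_mod_zero[OF assms(1-3)]
    by (simp add: M.M.l_neg)
  then show ?thesis
    using linear_mod_closed[OF assms(3)] assms(4) by (simp add: N.M.minus_equality)
qed

lemma linear_mod_minus:
  assumes "module K M" "module K N" "linear_mod K M N f" "x \<in> carrier M" "y \<in> carrier M"
  shows "f (x \<ominus>\<^bsub>M\<^esub> y) = f x \<ominus>\<^bsub>N\<^esub> f y"
proof -
  interpret M: module K M by fact
  interpret N: module K N by fact
  show ?thesis
    using assms linear_mod_add[OF assms(3), of x "\<ominus>\<^bsub>M\<^esub> y"] linear_mod_neg[OF assms(1-3), of y]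
    by (simp add: a_minus_def)
qed

lemmas linear_mod_hom = linear_mod_closed linear_mod_add linear_mod_smult
  linear_mod_zero linear_mod_neg linear_mod_minus

lemma linear_mod_compose:
  "linear_mod K M N f \<Longrightarrow> linear_mod K N P g \<Longrightarrow> linear_mod K M P (\<lambda>x. g (f x))"
  by (auto simp: linear_mod_def Pi_def)

lemma linear_mod_cong:
  assumes "\<And>x. x \<in> carrier M \<Longrightarrow> f x = g x" "module K M"
  shows "linear_mod K M N f \<longleftrightarrow> linear_mod K M N g"
proof -
  interpret M: module K M by fact
  show ?thesis
    using assms(1) by (auto simp: linear_mod_def Pi_iff)
qed

lemma linear_mod_add_fun:
  assumes "module K N" "linear_mod K M N f" "linear_mod K M N g"
  shows "linear_mod K M N (\<lambda>x. f x \<oplus>\<^bsub>N\<^esub> g x)"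
proof -
  interpret N: module K N by fact
  have "f (x \<oplus>\<^bsub>M\<^esub> y) \<oplus>\<^bsub>N\<^esub> g (x \<oplus>\<^bsub>M\<^esub> y) = f x \<oplus>\<^bsub>N\<^esub> g x \<oplus>\<^bsub>N\<^esub> (f y \<oplus>\<^bsub>N\<^esub> g y)"
    if "x \<in> carrier M" "y \<in> carrier M" for x y
    using that assms(2,3)[THEN linear_mod_closed] assms(2,3)[THEN linear_mod_add]
    by (simp add: N.M.a_ac)
  then show ?thesis
    using assms(2,3)[THEN linear_mod_closed] assms(2,3)[THEN linear_mod_smult]
    by (auto simp: linear_mod_def N.smult_r_distr)
qed

lemma linear_mod_neg_fun:
  assumes "module K N" "linear_mod K M N f"
  shows "linear_mod K M N (\<lambda>x. \<ominus>\<^bsub>N\<^esub> f x)"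
proof -
  interpret N: module K N by fact
  show ?thesis
    using linear_mod_closed[OF assms(2)] linear_mod_add[OF assms(2)] linear_mod_smult[OF assms(2)]
    by (auto simp: linear_mod_def N.smult_r_minus N.M.minus_add N.M.a_comm)
qed

lemma linear_mod_minus_fun:
  assumes "module K N" "linear_mod K M N f" "linear_mod K M N g"
  shows "linear_mod K M N (\<lambda>x. f x \<ominus>\<^bsub>N\<^esub> g x)"
  using linear_mod_add_fun[OF assms(1,2) linear_mod_neg_fun[OF assms(1,3)]]
  by (simp add: a_minus_def)

lemma linear_mod_zero_fun:
  assumes "module K N"
  shows "linear_mod K M N (\<lambda>x. \<zero>\<^bsub>N\<^esub>)"
proof -
  interpret N: module K N by fact
  show ?thesis by (auto simp: linear_mod_def)
qed

lemmas linear_mod_funs = linear_mod_add_fun linear_mod_minus_fun linear_mod_neg_fun linear_mod_zero_fun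

text \<open>A complement of the kernel yields a section.  By Zorn there is a maximal submodule \<open>C\<close> meeting the
  kernel of \<open>p\<close> trivially.  If \<open>p\<close> did not map \<open>C\<close> onto \<open>N\<close>, some \<open>p e\<close> would lie outside \<open>p ` C\<close>, and
  \<open>C + K e\<close> would be a larger such submodule: from \<open>p (c + a e) = 0\<close> with \<open>a \<noteq> 0\<close> one could divide by \<open>a\<close>
  and obtain \<open>p e\<close> in \<open>p ` C\<close>.\<close>

lemma linear_section_exists:
  assumes "field K" "module K M" "module K N" "linear_mod K M N p" "p ` carrier M = carrier N"
  shows "\<exists>s. linear_mod K N M s \<and> (\<forall>x\<in>carrier N. p (s x) = x)"
proof -
  interpret K: field K by fact
  interpret M: module K M by fact
  interpret N: module K N by fact
  note p = linear_mod_hom(1-3)[OF assms(4)] linear_mod_hom(4-)[OF assms(2-4)]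
  define \<C> where "\<C> = {C. submodule C K M \<and> (\<forall>c\<in>C. p c = \<zero>\<^bsub>N\<^esub> \<longrightarrow> c = \<zero>\<^bsub>M\<^esub>)}"
  have "\<exists>C\<in>\<C>. \<forall>D\<in>\<C>. C \<subseteq> D \<longrightarrow> D = C"
  proof (rule subset_Zorn_nonempty)
    have "{\<zero>\<^bsub>M\<^esub>} \<in> \<C>"
      by (auto simp: \<C>_def intro!: M.submoduleI)
    then show "\<C> \<noteq> {}" by blast
    fix \<D> assume ne: "\<D> \<noteq> {}" and chain: "subset.chain \<C> \<D>"
    have D: "submodule D K M" if "D \<in> \<D>" for D
      using chain that by (auto simp: subset.chain_def \<C>_def)
    have "submodule (\<Union>\<D>) K M"
    proof (rule M.submoduleI)
      show "\<Union>\<D> \<subseteq> carrier M"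
        using M.submoduleE(1)[OF D] by blast
      show "\<zero>\<^bsub>M\<^esub> \<in> \<Union>\<D>"
        using ne D submodule.axioms(1)[THEN subgroup.one_closed] by fastforce
      show "\<ominus>\<^bsub>M\<^esub> a \<in> \<Union>\<D>" if "a \<in> \<Union>\<D>" for a
        using that M.submoduleE(3)[OF D] by blast
      show "a \<odot>\<^bsub>M\<^esub> x \<in> \<Union>\<D>" if "a \<in> carrier K" "x \<in> \<Union>\<D>" for a x
        using that M.submoduleE(4)[OF D] by blast
      show "a \<oplus>\<^bsub>M\<^esub> b \<in> \<Union>\<D>" if ab: "a \<in> \<Union>\<D>" "b \<in> \<Union>\<D>" for a b
      proof -
        obtain A B where "A \<in> \<D>" "B \<in> \<D>" "a \<in> A" "b \<in> B"
          using ab by blast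
        moreover from this have "A \<subseteq> B \<or> B \<subseteq> A"
          using chain by (auto simp: subset.chain_def)
        ultimately show ?thesis
          using M.submoduleE(5)[OF D] by blast
      qed
    qed
    then show "\<Union>\<D> \<in> \<C>"
      using chain by (auto simp: \<C>_def subset.chain_def)
  qed
  then obtain C where "C \<in> \<C>" and maximal: "\<And>D. D \<in> \<C> \<Longrightarrow> C \<subseteq> D \<Longrightarrow> D = C"
    by blast
  then have C: "submodule C K M" and C_ker: "\<And>c. c \<in> C \<Longrightarrow> p c = \<zero>\<^bsub>N\<^esub> \<Longrightarrow> c = \<zero>\<^bsub>M\<^esub>"
    by (auto simp: \<C>_def)
  note C_closed = M.submoduleE[OF C]
  have C_carrier: "c \<in> C \<Longrightarrow> c \<in> carrier M" for c
    using C_closed(1) by blast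
  have C_zero: "\<zero>\<^bsub>M\<^esub> \<in> C"
    using submodule.axioms(1)[OF C, THEN subgroup.one_closed] by simp
  have inj: "inj_on p C"
  proof (rule inj_onI)
    fix c d assume cd: "c \<in> C" "d \<in> C" "p c = p d"
    have "c \<ominus>\<^bsub>M\<^esub> d = \<zero>\<^bsub>M\<^esub>"
      using cd C_closed C_carrier by (intro C_ker) (auto simp: p a_minus_def N.M.r_neg)
    moreover have "(c \<ominus>\<^bsub>M\<^esub> d) \<oplus>\<^bsub>M\<^esub> d = c"
      using cd C_carrier by (simp add: a_minus_def M.M.a_assoc M.M.l_neg)
    ultimately show "c = d"
      using cd C_carrier by simp
  qed
  have surj: "p ` C = carrier N"
  proof (rule ccontr)
    assume "p ` C \<noteq> carrier N"
    then obtain e where e: "e \<in> carrier M" "p e \<notin> p ` C"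
      using assms(5) C_carrier by (auto simp: set_eq_iff image_iff) metis
    define D where "D = {c \<oplus>\<^bsub>M\<^esub> a \<odot>\<^bsub>M\<^esub> e | c a. c \<in> C \<and> a \<in> carrier K}"
    have D_intro: "c \<in> C \<Longrightarrow> a \<in> carrier K \<Longrightarrow> c \<oplus>\<^bsub>M\<^esub> a \<odot>\<^bsub>M\<^esub> e \<in> D" for c a
      by (auto simp: D_def)
    have "submodule D K M"
    proof (rule M.submoduleI)
      show "D \<subseteq> carrier M"
        using e C_carrier by (auto simp: D_def)
      show "\<zero>\<^bsub>M\<^esub> \<in> D"
        using D_intro[OF C_zero K.zero_closed] e by simp
      show "\<ominus>\<^bsub>M\<^esub> x \<in> D" if x: "x \<in> D" for x
      proof -
        obtain c a where ca: "c \<in> C" "a \<in> carrier K" "x = c \<oplus>\<^bsub>M\<^esub> a \<odot>\<^bsub>M\<^esub> e"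
          using x by (auto simp: D_def)
        have "\<ominus>\<^bsub>M\<^esub> x = \<ominus>\<^bsub>M\<^esub> c \<oplus>\<^bsub>M\<^esub> (\<ominus>\<^bsub>K\<^esub> a) \<odot>\<^bsub>M\<^esub> e"
          using ca e C_carrier by (simp add: M.smult_l_minus M.M.minus_add M.M.a_comm)
        then show ?thesis
          using ca C_closed D_intro by simp
      qed
      show "x \<oplus>\<^bsub>M\<^esub> y \<in> D" if xy: "x \<in> D" "y \<in> D" for x y
      proof -
        obtain c a d b where *: "c \<in> C" "a \<in> carrier K" "x = c \<oplus>\<^bsub>M\<^esub> a \<odot>\<^bsub>M\<^esub> e"
            "d \<in> C" "b \<in> carrier K" "y = d \<oplus>\<^bsub>M\<^esub> b \<odot>\<^bsub>M\<^esub> e"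
          using xy by (auto simp: D_def)
        have "x \<oplus>\<^bsub>M\<^esub> y = (c \<oplus>\<^bsub>M\<^esub> d) \<oplus>\<^bsub>M\<^esub> (a \<oplus>\<^bsub>K\<^esub> b) \<odot>\<^bsub>M\<^esub> e"
          using * e C_carrier by (simp add: M.smult_l_distr M.M.a_ac)
        then show ?thesis
          using * C_closed D_intro by simp
      qed
      show "b \<odot>\<^bsub>M\<^esub> x \<in> D" if bx: "b \<in> carrier K" "x \<in> D" for b x
      proof -
        obtain c a where ca: "c \<in> C" "a \<in> carrier K" "x = c \<oplus>\<^bsub>M\<^esub> a \<odot>\<^bsub>M\<^esub> e"
          using bx by (auto simp: D_def)
        have "b \<odot>\<^bsub>M\<^esub> x = b \<odot>\<^bsub>M\<^esub> c \<oplus>\<^bsub>M\<^esub> (b \<otimes>\<^bsub>K\<^esub> a) \<odot>\<^bsub>M\<^esub> e"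
          using ca e bx C_carrier by (simp add: M.smult_assoc1 M.smult_r_distr)
        then show ?thesis
          using ca bx C_closed D_intro by simp
      qed
    qed
    moreover have "x = \<zero>\<^bsub>M\<^esub>" if x: "x \<in> D" "p x = \<zero>\<^bsub>N\<^esub>" for x
    proof -
      obtain c a where ca: "c \<in> C" "a \<in> carrier K" "x = c \<oplus>\<^bsub>M\<^esub> a \<odot>\<^bsub>M\<^esub> e"
        using x by (auto simp: D_def)
      have "a = \<zero>\<^bsub>K\<^esub>"
      proof (rule ccontr)
        assume "a \<noteq> \<zero>\<^bsub>K\<^esub>"
        then have a: "a \<in> Units K"
          using ca by (simp add: K.field_Units)
        have "a \<odot>\<^bsub>N\<^esub> p e \<oplus>\<^bsub>N\<^esub> p c = \<zero>\<^bsub>N\<^esub>"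
          using x ca e C_carrier by (simp add: p N.M.a_comm)
        then have "a \<odot>\<^bsub>N\<^esub> p e = \<ominus>\<^bsub>N\<^esub> p c"
          using ca e C_carrier by (intro N.M.minus_equality[symmetric]) (simp_all add: p)
        then have "inv\<^bsub>K\<^esub> a \<odot>\<^bsub>N\<^esub> (a \<odot>\<^bsub>N\<^esub> p e) = p (\<ominus>\<^bsub>M\<^esub> (inv\<^bsub>K\<^esub> a \<odot>\<^bsub>M\<^esub> c))"
          using ca a C_carrier by (simp add: p N.smult_r_minus)
        moreover have "inv\<^bsub>K\<^esub> a \<odot>\<^bsub>N\<^esub> (a \<odot>\<^bsub>N\<^esub> p e) = p e"
          using a e ca by (simp add: p N.smult_assoc1[symmetric])
        ultimately show False
          using e(2) ca a C_closed by (metis K.Units_inv_closed imageI)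
      qed
      then have "x = c"
        using ca e C_carrier by simp
      then show ?thesis
        using x ca C_ker by blast
    qed
    ultimately have "D \<in> \<C>"
      unfolding \<C>_def by blast
    moreover have "C \<subseteq> D"
      using D_intro[OF _ K.zero_closed] e C_carrier by fastforce
    ultimately have "D = C"
      by (rule maximal)
    moreover have "e \<in> D"
      using D_intro[OF C_zero K.one_closed] e by simp
    ultimately show False
      using e by blast
  qed
  define s where "s = inv_into C p"
  have s: "s x \<in> C" "p (s x) = x" if "x \<in> carrier N" for x
    using that surj by (auto simp: s_def inv_into_into f_inv_into_f)
  have s_eq: "s x = c" if "x \<in> carrier N" "c \<in> C" "p c = x" for x c
    using that s inj by (auto simp: inj_on_def)
  have "linear_mod K N M s"
    unfolding linear_mod_def
    using s C_closed C_carrier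
    by (auto intro!: s_eq simp: p)
  then show ?thesis
    using s by blast
qed

section \<open>Cochains of low degree\<close>

definition alternating_bilinear ::
  "('k, 'm) ring_scheme \<Rightarrow> ('k, 'a, 'n) module_scheme \<Rightarrow> ('k, 'b, 'p) module_scheme
     \<Rightarrow> ('a \<Rightarrow> 'a \<Rightarrow> 'b) \<Rightarrow> bool" where
  "alternating_bilinear K M N F \<longleftrightarrow>
     (\<forall>y\<in>carrier M. linear_mod K M N (\<lambda>x. F x y)) \<and>
     (\<forall>x\<in>carrier M. linear_mod K M N (F x)) \<and>
     (\<forall>x\<in>carrier M. F x x = \<zero>\<^bsub>N\<^esub>)"

lemma alternating_bilinear_linear:
  assumes "alternating_bilinear K M N F"
  shows "y \<in> carrier M \<Longrightarrow> linear_mod K M N (\<lambda>x. F x y)"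
    and "x \<in> carrier M \<Longrightarrow> linear_mod K M N (F x)"
    and "x \<in> carrier M \<Longrightarrow> F x x = \<zero>\<^bsub>N\<^esub>"
  using assms by (auto simp: alternating_bilinear_def)

lemmas alternating_bilinear_hom =
  linear_mod_hom(1)[OF alternating_bilinear_linear(2)]
  linear_mod_hom(2)[OF alternating_bilinear_linear(1)]
  linear_mod_hom(2)[OF alternating_bilinear_linear(2)]
  linear_mod_hom(3)[OF alternating_bilinear_linear(1)]
  linear_mod_hom(3)[OF alternating_bilinear_linear(2)]

text \<open>Polarization: expand \<open>F (x + y) (x + y) = 0\<close>.\<close>

lemma alternating_bilinear_skew:
  assumes "module K M" "module K N" "alternating_bilinear K M N F" "x \<in> carrier M" "y \<in> carrier M"
  shows "F x y = \<ominus>\<^bsub>N\<^esub> F y x"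
proof -
  interpret M: module K M by fact
  interpret N: module K N by fact
  note F = alternating_bilinear_hom[OF assms(3)] alternating_bilinear_linear(3)[OF assms(3)]
  have "F (x \<oplus>\<^bsub>M\<^esub> y) (x \<oplus>\<^bsub>M\<^esub> y) = \<zero>\<^bsub>N\<^esub>"
    using assms by (intro F) auto
  moreover have "F (x \<oplus>\<^bsub>M\<^esub> y) (x \<oplus>\<^bsub>M\<^esub> y) = F x y \<oplus>\<^bsub>N\<^esub> F y x"
    using assms alternating_bilinear_hom(1)[OF assms(3)]
    by (simp add: alternating_bilinear_hom(2-)[OF assms(3)]
          alternating_bilinear_linear(3)[OF assms(3), of x] alternating_bilinear_linear(3)[OF assms(3), of y] N.M.a_comm)
  ultimately have "F x y \<oplus>\<^bsub>N\<^esub> F y x = \<zero>\<^bsub>N\<^esub>"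
    by simp
  then show ?thesis
    using assms by (intro N.M.minus_equality[symmetric]) (auto simp: F N.M.a_comm)
qed

lemma mem_tuples_1: "xs \<in> tuples L (Suc 0) \<longleftrightarrow> (\<exists>x\<in>carrier L. xs = [x])"
  by (auto simp: tuples_def length_Suc_conv)

lemma mem_tuples_2: "xs \<in> tuples L 2 \<longleftrightarrow> (\<exists>x\<in>carrier L. \<exists>y\<in>carrier L. xs = [x, y])"
  by (auto simp: tuples_def length_Suc_conv numeral_2_eq_2)

lemma ball_tuples_1: "(\<forall>xs\<in>tuples L (Suc 0). P xs) \<longleftrightarrow> (\<forall>x\<in>carrier L. P [x])"
  by (auto simp: mem_tuples_1)

lemma ball_tuples_2:
  "(\<forall>xs\<in>tuples L 2. P xs) \<longleftrightarrow> (\<forall>x\<in>carrier L. \<forall>y\<in>carrier L. P [x, y])"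
  by (auto simp: mem_tuples_2)

lemma mem_tuples_3:
  "xs \<in> tuples L 3 \<longleftrightarrow> (\<exists>x\<in>carrier L. \<exists>y\<in>carrier L. \<exists>z\<in>carrier L. xs = [x, y, z])"
  by (auto simp: tuples_def length_Suc_conv numeral_3_eq_3)

lemma ball_tuples_3:
  "(\<forall>xs\<in>tuples L 3. P xs) \<longleftrightarrow> (\<forall>x\<in>carrier L. \<forall>y\<in>carrier L. \<forall>z\<in>carrier L. P [x, y, z])"
  by (auto simp: mem_tuples_3)

text \<open>Alternating maps on 1- and 2-tuples correspond to ordinary linear maps and alternating bilinear maps;
  the calculations below use the latter.\<close>

lemma alt_maps_1_iff:
  assumes "module K L"
  shows "(\<lambda>xs\<in>tuples L 1. G (xs ! 0)) \<in> alt_maps K L V 1 \<longleftrightarrow> linear_mod K L V G"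
proof -
  define f where "f = (\<lambda>xs\<in>tuples L 1. G (xs ! 0))"
  have "linear_mod K L V (\<lambda>x. f [x]) \<longleftrightarrow> linear_mod K L V G"
    by (rule linear_mod_cong[OF _ assms]) (auto simp: mem_tuples_1 f_def)
  moreover have "f \<in> tuples L 1 \<rightarrow>\<^sub>E carrier V" if "linear_mod K L V G"
    using that by (auto simp: mem_tuples_1 linear_mod_closed f_def)
  moreover have "carrier L \<noteq> {}"
    using abelian_groupE(2)[OF module.axioms(2)[OF assms]] by blast
  ultimately show ?thesis
    unfolding f_def[symmetric] by (auto simp: alt_maps_def ball_tuples_1)
qed

lemma alt_maps_2_iff:
  assumes "module K L"
  shows "(\<lambda>xs\<in>tuples L 2. F (xs ! 0) (xs ! 1)) \<in> alt_maps K L V 2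
    \<longleftrightarrow> alternating_bilinear K L V F"
proof -
  define f where "f = (\<lambda>xs\<in>tuples L 2. F (xs ! 0) (xs ! 1))"
  have left: "linear_mod K L V (\<lambda>x. f [x, y]) \<longleftrightarrow> linear_mod K L V (\<lambda>x. F x y)"
    and right: "linear_mod K L V (\<lambda>x. f [y, x]) \<longleftrightarrow> linear_mod K L V (F y)"
    if "y \<in> carrier L" for y
    using that by (auto intro!: linear_mod_cong[OF _ assms] simp: mem_tuples_2 f_def)
  have ne: "carrier L \<noteq> {}"
    using abelian_groupE(2)[OF module.axioms(2)[OF assms]] by blast
  have "(\<forall>xs\<in>tuples L 2. \<forall>i<2. linear_mod K L V (\<lambda>x. f (xs[i := x])))
      \<longleftrightarrow> (\<forall>y\<in>carrier L. linear_mod K L V (\<lambda>x. f [x, y]) \<and> linear_mod K L V (\<lambda>x. f [y, x]))"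
    using ne by (auto simp: ball_tuples_2 less_2_cases_iff)
  moreover have "(\<forall>xs\<in>tuples L 2. \<forall>i<2. \<forall>j<2. i \<noteq> j \<longrightarrow> xs ! i = xs ! j \<longrightarrow> f xs = \<zero>\<^bsub>V\<^esub>)
      \<longleftrightarrow> (\<forall>x\<in>carrier L. F x x = \<zero>\<^bsub>V\<^esub>)"
    unfolding ball_tuples_2 by (auto simp: less_2_cases_iff mem_tuples_2 f_def)
  moreover have "f \<in> tuples L 2 \<rightarrow>\<^sub>E carrier V" if "alternating_bilinear K L V F"
    using that by (auto simp: mem_tuples_2 alternating_bilinear_hom f_def)
  ultimately show ?thesis
    using left right unfolding f_def[symmetric] by (auto simp: alt_maps_def alternating_bilinear_def)
qed

lemma alt_maps_1_eq: "f \<in> alt_maps K L V 1 \<Longrightarrow> f = (\<lambda>xs\<in>tuples L 1. f [xs ! 0])"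
  by (rule ext) (auto simp: alt_maps_def mem_tuples_1 restrict_def PiE_iff extensional_def)

lemma alt_maps_2_eq: "f \<in> alt_maps K L V 2 \<Longrightarrow> f = (\<lambda>xs\<in>tuples L 2. f [xs ! 0, xs ! 1])"
  by (rule ext) (auto simp: alt_maps_def mem_tuples_2 restrict_def PiE_iff extensional_def)

lemma (in module) sign_smult:
  "x \<in> carrier M \<Longrightarrow> sign R m \<odot>\<^bsub>M\<^esub> x = (if even m then x else \<ominus>\<^bsub>M\<^esub> x)"
proof -
  have "sign R m = (if even m then \<one> else \<ominus> \<one>)"
    by (induction m) (auto simp: sign_def R.r_minus R.l_minus)
  then show "x \<in> carrier M \<Longrightarrow> ?thesis"
    by (simp add: smult_l_minus)
qed

text \<open>In the following formulas for the differentials, only closure is assumed of the bracket and the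
  action, so that they apply to the deformed bracket and the deformed action as well.\<close>

lemma ce_diff_0:
  assumes "module K V" "\<And>x u. x \<in> carrier L \<Longrightarrow> u \<in> carrier V \<Longrightarrow> \<rho> x u \<in> carrier V"
    and "f [] \<in> carrier V" "x \<in> carrier L"
  shows "ce_diff K L V \<rho> 0 f [x] = \<ominus>\<^bsub>V\<^esub> \<rho> x (f [])"
proof -
  interpret V: module K V by fact
  have [simp]: "{(i, j). Suc 0 \<le> i \<and> i < j \<and> j \<le> Suc 0} = {}" by auto
  show ?thesis
    using assms by (simp add: ce_diff_def mem_tuples_1 entry_def omit_def V.sign_smult)
qed

lemma ce_diff_1:
  assumes "module K V" "\<And>x u. x \<in> carrier L \<Longrightarrow> u \<in> carrier V \<Longrightarrow> \<rho> x u \<in> carrier V"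
    and "\<And>x y. x \<in> carrier L \<Longrightarrow> y \<in> carrier L \<Longrightarrow> bracket L x y \<in> carrier L"
    and "\<And>x. x \<in> carrier L \<Longrightarrow> f [x] \<in> carrier V" "x \<in> carrier L" "y \<in> carrier L"
  shows "ce_diff K L V \<rho> 1 f [x, y] = \<rho> x (f [y]) \<ominus>\<^bsub>V\<^esub> \<rho> y (f [x]) \<ominus>\<^bsub>V\<^esub> f [bracket L x y]"
proof -
  interpret V: module K V by fact
  have ij: "{(i, j). Suc 0 \<le> i \<and> i < j \<and> j \<le> Suc (Suc 0)} = {(Suc 0, Suc (Suc 0))}" by auto
  have i: "{Suc 0..Suc (Suc 0)} = {Suc 0, Suc (Suc 0)}" by auto
  show ?thesis
    using assms unfolding ce_diff_def
    by (simp add: mem_tuples_2[unfolded numeral_2_eq_2] ij i entry_def omit_def V.sign_smult a_minus_def)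
qed

lemma ce_diff_2:
  assumes "module K V" "\<And>x u. x \<in> carrier L \<Longrightarrow> u \<in> carrier V \<Longrightarrow> \<rho> x u \<in> carrier V"
    and "\<And>x y. x \<in> carrier L \<Longrightarrow> y \<in> carrier L \<Longrightarrow> bracket L x y \<in> carrier L"
    and "\<And>x y. x \<in> carrier L \<Longrightarrow> y \<in> carrier L \<Longrightarrow> f [x, y] \<in> carrier V"
    and "x \<in> carrier L" "y \<in> carrier L" "z \<in> carrier L"
  shows "ce_diff K L V \<rho> 2 f [x, y, z] =
    \<ominus>\<^bsub>V\<^esub> \<rho> x (f [y, z]) \<oplus>\<^bsub>V\<^esub> \<rho> y (f [x, z]) \<ominus>\<^bsub>V\<^esub> \<rho> z (f [x, y])
      \<oplus>\<^bsub>V\<^esub> f [bracket L x y, z] \<ominus>\<^bsub>V\<^esub> f [bracket L x z, y] \<oplus>\<^bsub>V\<^esub> f [bracket L y z, x]"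
proof -
  interpret V: module K V by fact
  have ij: "{(i, j). 1 \<le> i \<and> i < j \<and> j \<le> (2::nat) + 1} = {(1, 2), (1, 3), (2, 3)}" by auto
  have i: "{1..(2::nat) + 1} = {1, 2, 3}" by auto
  show ?thesis
    using assms unfolding ce_diff_def ij i
    by (simp add: mem_tuples_3 entry_def omit_def V.sign_smult a_minus_def V.M.a_assoc)
qed

lemma rb_phi_1:
  assumes "module K V" "\<And>u. u \<in> carrier V \<Longrightarrow> S u \<in> carrier V"
    and "\<And>x. x \<in> carrier L \<Longrightarrow> f [x] \<in> carrier V" "x \<in> carrier L"
  shows "rb_phi K lam L T V S 1 f [x] = f [T x] \<ominus>\<^bsub>V\<^esub> S (f [x])"
proof -
  interpret V: module K V by fact
  have "{I. I \<subseteq> {Suc 0} \<and> card I = 0} = {{}}" by (auto dest: finite_subset simp: card_eq_0_iff)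
  then show ?thesis
    using assms by (simp add: rb_phi_def mem_tuples_1 apply_at_def entry_def)
qed

lemma rb_phi_2:
  assumes "module K V" "lam \<in> carrier K" "\<And>u. u \<in> carrier V \<Longrightarrow> S u \<in> carrier V"
    and "\<And>x. x \<in> carrier L \<Longrightarrow> T x \<in> carrier L"
    and "\<And>x y. x \<in> carrier L \<Longrightarrow> y \<in> carrier L \<Longrightarrow> f [x, y] \<in> carrier V" "x \<in> carrier L" "y \<in> carrier L"
  shows "rb_phi K lam L T V S 2 f [x, y] =
    f [T x, T y] \<ominus>\<^bsub>V\<^esub> (lam \<odot>\<^bsub>V\<^esub> S (f [x, y]) \<oplus>\<^bsub>V\<^esub> S (f [T x, y]) \<oplus>\<^bsub>V\<^esub> S (f [x, T y]))"
proof -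
  interpret V: module K V by fact
  have fin: "I \<subseteq> {1..2} \<Longrightarrow> finite I" for I :: "nat set"
    by (rule finite_subset) auto
  have 0: "{I. I \<subseteq> {1..2} \<and> card I = 0} = {{} :: nat set}"
    using fin by (auto simp: card_eq_0_iff)
  have "I = {1} \<or> I = {2}" if I: "I \<subseteq> {1..2::nat}" "card I = 1" for I
  proof -
    obtain i where "I = {i}" using I(2) by (auto simp: card_1_singleton_iff)
    with I(1) show ?thesis by auto
  qed
  then have 1: "{I. I \<subseteq> {1..2} \<and> card I = 1} = {{1}, {2} :: nat set}"
    by auto
  have k: "{0..<2} = {0, 1 :: nat}" by auto
  have at: "apply_at T {} [x, y] = [x, y]" "apply_at T {1} [x, y] = [T x, y]"
    "apply_at T {2} [x, y] = [x, T y]"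
    by (simp_all add: apply_at_def entry_def)
  have S0: "(\<Oplus>\<^bsub>V\<^esub>I\<in>{I. I \<subseteq> {1..2} \<and> card I = 0}. S (f (apply_at T I [x, y]))) = S (f [x, y])"
    unfolding 0 using assms by (simp add: at)
  have S1: "(\<Oplus>\<^bsub>V\<^esub>I\<in>{I. I \<subseteq> {1..2} \<and> card I = 1}. S (f (apply_at T I [x, y])))
      = S (f [T x, y]) \<oplus>\<^bsub>V\<^esub> S (f [x, T y])"
    unfolding 1 using assms at(2) by (simp add: at)
  have two_terms: "(\<Oplus>\<^bsub>V\<^esub>k\<in>{0, 1::nat}. g k) = g 0 \<oplus>\<^bsub>V\<^esub> g 1" if "g 0 \<in> carrier V" "g 1 \<in> carrier V" for g
    using that by simp
  have mem: "[x, y] \<in> tuples L 2"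
    using assms by (simp add: mem_tuples_2)
  show ?thesis
    using assms unfolding rb_phi_def k restrict_apply'[OF mem]
    by (subst two_terms) (simp_all only: S0 S1, simp_all add: V.M.a_assoc)
qed


section \<open>The second cohomology\<close>

context lie_algebra
begin

lemma bracket_bilinear: "alternating_bilinear K L L (bracket L)"
  by (auto simp: alternating_bilinear_def bracket_linear_left bracket_linear_right bracket_alternating)

lemma module_L: "module K L" ..

lemmas bracket_hom [simp] =
  alternating_bilinear_hom[OF bracket_bilinear]
  linear_mod_hom(4-)[OF module_L module_L bracket_linear_left]
  linear_mod_hom(4-)[OF module_L module_L bracket_linear_right]

lemma bracket_skew: "x \<in> carrier L \<Longrightarrow> y \<in> carrier L \<Longrightarrow> bracket L x y = \<ominus>\<^bsub>L\<^esub> bracket L y x"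
  by (rule alternating_bilinear_skew[OF module_L module_L bracket_bilinear])

end

context rota_baxter_lie
begin

lemmas op_hom [simp] =
  linear_mod_hom(1-3)[OF op_linear] linear_mod_hom(4-)[OF module_L module_L op_linear]

lemma deformed_bracket_closed [simp]:
  "x \<in> carrier L \<Longrightarrow> y \<in> carrier L \<Longrightarrow> deformed_bracket lam L T x y \<in> carrier L"
  using weight_closed by (simp add: deformed_bracket_def)

end

text \<open>The 2-cochain of the complex given by a binary and a unary function, which matter only on the carrier.\<close>

definition cochain_of_pair ::
  "('a, 'm) partial_object_scheme \<Rightarrow> ('a \<Rightarrow> 'a \<Rightarrow> 'v) \<Rightarrow> ('a \<Rightarrow> 'v) \<Rightarrow> ('a list \<Rightarrow> 'v) \<times> ('a list \<Rightarrow> 'v)"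
  where
  "cochain_of_pair L F G =
     (\<lambda>xs\<in>tuples L 2. F (xs ! 0) (xs ! 1), \<lambda>xs\<in>tuples L 1. G (xs ! 0))"

lemma cochain_of_pair_eq_iff:
  "cochain_of_pair L F G = cochain_of_pair L F' G' \<longleftrightarrow>
     (\<forall>x\<in>carrier L. \<forall>y\<in>carrier L. F x y = F' x y) \<and> (\<forall>x\<in>carrier L. G x = G' x)"
proof -
  have "restrict f A = restrict g A \<longleftrightarrow> (\<forall>x\<in>A. f x = g x)" for f g :: "'a list \<Rightarrow> 'b" and A
    by (auto simp: restrict_def fun_eq_iff)
  then show ?thesis
    by (simp add: cochain_of_pair_def ball_tuples_1 ball_tuples_2)
qed

context rb_representation
begin

lemma module_V: "module K V" ..

lemmas rep_op_hom [simp] =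
  linear_mod_hom(1-3)[OF rep_op_linear] linear_mod_hom(4-)[OF module_V module_V rep_op_linear]

lemmas action_hom [simp] =
  linear_mod_hom(1-3)[OF action_linear] linear_mod_hom(4-)[OF module_V module_V action_linear]
  linear_mod_hom(2-3)[OF action_linear_left] linear_mod_hom(4-)[OF module_L module_V action_linear_left]

lemma deformed_action_closed [simp]:
  "x \<in> carrier L \<Longrightarrow> u \<in> carrier V \<Longrightarrow> deformed_action T V \<rho> S x u \<in> carrier V"
  by (simp add: deformed_action_def)

text \<open>The two equations are the \<open>V\<close>-components of the Jacobi identity and of the Rota-Baxter identity in the
  extension with bracket \<open>[(x, u), (y, v)] = ([x, y], F x y + \<rho> x v - \<rho> y u)\<close> and operator
  \<open>(x, u) \<mapsto> (T x, G x + S u)\<close>, evaluated at elements with zero \<open>V\<close>-component.\<close>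

definition cocycle_pair where
  "cocycle_pair F G \<longleftrightarrow>
     alternating_bilinear K L V F \<and> linear_mod K L V G \<and>
     (\<forall>x\<in>carrier L. \<forall>y\<in>carrier L. \<forall>z\<in>carrier L.
        \<rho> x (F y z) \<oplus>\<^bsub>V\<^esub> \<rho> y (F z x) \<oplus>\<^bsub>V\<^esub> \<rho> z (F x y)
        \<oplus>\<^bsub>V\<^esub> F x (bracket L y z) \<oplus>\<^bsub>V\<^esub> F y (bracket L z x) \<oplus>\<^bsub>V\<^esub> F z (bracket L x y) = \<zero>\<^bsub>V\<^esub>) \<and>
     (\<forall>x\<in>carrier L. \<forall>y\<in>carrier L.
        F (T x) (T y) \<oplus>\<^bsub>V\<^esub> \<rho> (T x) (G y) \<ominus>\<^bsub>V\<^esub> \<rho> (T y) (G x) =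
        S (F (T x) y \<oplus>\<^bsub>V\<^esub> F x (T y) \<oplus>\<^bsub>V\<^esub> lam \<odot>\<^bsub>V\<^esub> F x y \<oplus>\<^bsub>V\<^esub> \<rho> x (G y) \<ominus>\<^bsub>V\<^esub> \<rho> y (G x))
        \<oplus>\<^bsub>V\<^esub> G (deformed_bracket lam L T x y))"

text \<open>The two components of the coboundary of the 1-cochain \<open>(h, 0)\<close>.\<close>

definition coboundary_bracket where
  "coboundary_bracket h x y = \<rho> x (h y) \<ominus>\<^bsub>V\<^esub> \<rho> y (h x) \<ominus>\<^bsub>V\<^esub> h (bracket L x y)"

definition coboundary_op where
  "coboundary_op h x = S (h x) \<ominus>\<^bsub>V\<^esub> h (T x)"

text \<open>Up to sign, skew-symmetry of \<open>F\<close> turns the Chevalley-Eilenberg differential of \<open>F\<close> into the cyclic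
  sum of the first cocycle equation, and the second component of the differential is the difference of the
  two sides of the second equation.\<close>

lemma cocycle_iff: "cochain_of_pair L F G \<in> rb_cocycles K lam L T V \<rho> S 2 \<longleftrightarrow> cocycle_pair F G"
proof (cases "alternating_bilinear K L V F \<and> linear_mod K L V G")
  case False
  then show ?thesis
    using alt_maps_2_iff[OF module_L] alt_maps_1_iff[OF module_L]
    by (auto simp: rb_cocycles_def kernel_def rb_cochains_def cocycle_pair_def cochain_of_pair_def
        alt_group_def numeral_2_eq_2)
next
  case True
  then have F: "alternating_bilinear K L V F" and G: "linear_mod K L V G"
    by auto
  note F_simps = alternating_bilinear_hom[OF F]
  note G_simps = linear_mod_hom(1-3)[OF G] linear_mod_hom(4-)[OF module_L module_V G]
  define f where "f = (\<lambda>xs\<in>tuples L 2. F (xs ! 0) (xs ! 1))"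
  define g where "g = (\<lambda>xs\<in>tuples L 1. G (xs ! 0))"
  have f: "f [x, y] = F x y" if "x \<in> carrier L" "y \<in> carrier L" for x y
    using that by (simp add: f_def mem_tuples_2)
  have g: "g [x] = G x" if "x \<in> carrier L" for x
    using that by (simp add: g_def mem_tuples_1)
  have fg: "f \<in> alt_maps K L V 2" "g \<in> alt_maps K L V 1"
    unfolding f_def g_def using F G alt_maps_2_iff[OF module_L] alt_maps_1_iff[OF module_L] by auto
  let ?d1 = "ce_diff K L V \<rho> 2 f"
  let ?d2 = "\<lambda>xs. \<ominus>\<^bsub>V\<^esub> ce_diff K (deformed lam L T) V (deformed_action T V \<rho> S) 1 g xs
      \<ominus>\<^bsub>V\<^esub> rb_phi K lam L T V S 2 f xs"
  have kernel: "cochain_of_pair L F G \<in> rb_cocycles K lam L T V \<rho> S 2 \<longleftrightarrow>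
      (\<forall>xs\<in>tuples L 3. ?d1 xs = \<zero>\<^bsub>V\<^esub>) \<and> (\<forall>xs\<in>tuples L 2. ?d2 xs = \<zero>\<^bsub>V\<^esub>)"
  proof -
    have pair: "cochain_of_pair L F G = (f, g)"
      by (simp add: cochain_of_pair_def f_def g_def)
    have mem: "(f, g) \<in> carrier (rb_cochains K L V 2)"
      using fg by (simp add: rb_cochains_def alt_group_def numeral_2_eq_2)
    have diff: "rb_diff K lam L T V \<rho> S 2 (f, g) = (restrict ?d1 (tuples L 3), restrict ?d2 (tuples L 2))"
      by (simp add: numeral_2_eq_2 numeral_3_eq_3 ce_diff_def restrict_def fun_eq_iff)
    have one: "\<one>\<^bsub>rb_cochains K L V (Suc 2)\<^esub> = (\<lambda>xs\<in>tuples L 3. \<zero>\<^bsub>V\<^esub>, \<lambda>xs\<in>tuples L 2. \<zero>\<^bsub>V\<^esub>)"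
      by (simp add: rb_cochains_def alt_group_def numeral_2_eq_2 numeral_3_eq_3)
    have "restrict a A = restrict b A \<longleftrightarrow> (\<forall>x\<in>A. a x = b x)"
      for a b :: "'c list \<Rightarrow> 'e" and A
      by (auto simp: restrict_def fun_eq_iff)
    then show ?thesis
      unfolding rb_cocycles_def kernel_def pair by (simp only: mem_Collect_eq mem diff one prod.inject simp_thms)
  qed
  have J: "?d1 [x, y, z] = \<ominus>\<^bsub>V\<^esub> (\<rho> x (F y z) \<oplus>\<^bsub>V\<^esub> \<rho> y (F z x) \<oplus>\<^bsub>V\<^esub> \<rho> z (F x y)
        \<oplus>\<^bsub>V\<^esub> F x (bracket L y z) \<oplus>\<^bsub>V\<^esub> F y (bracket L z x) \<oplus>\<^bsub>V\<^esub> F z (bracket L x y))"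
    if xyz: "x \<in> carrier L" "y \<in> carrier L" "z \<in> carrier L" for x y z
  proof -
    note skew = alternating_bilinear_skew[OF module_L module_V F]
    have "F z x = \<ominus>\<^bsub>V\<^esub> F x z" "F x (bracket L y z) = \<ominus>\<^bsub>V\<^esub> F (bracket L y z) x"
      "F z (bracket L x y) = \<ominus>\<^bsub>V\<^esub> F (bracket L x y) z"
      using xyz by (intro skew; simp)+
    moreover have "F y (bracket L z x) = F (bracket L x z) y"
    proof -
      have "F y (bracket L z x) = F y (\<ominus>\<^bsub>L\<^esub> bracket L x z)"
        using xyz bracket_skew[of z x] by simp
      also have "\<dots> = \<ominus>\<^bsub>V\<^esub> F y (bracket L x z)"
        using xyz by (intro linear_mod_neg[OF module_L module_V alternating_bilinear_linear(2)[OF F]]) auto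
      also have "\<dots> = F (bracket L x z) y"
        using xyz skew[of y "bracket L x z"] by (simp add: F_simps)
      finally show ?thesis .
    qed
    moreover have "?d1 [x, y, z] =
        \<ominus>\<^bsub>V\<^esub> \<rho> x (F y z) \<oplus>\<^bsub>V\<^esub> \<rho> y (F x z) \<ominus>\<^bsub>V\<^esub> \<rho> z (F x y)
        \<oplus>\<^bsub>V\<^esub> F (bracket L x y) z \<ominus>\<^bsub>V\<^esub> F (bracket L x z) y \<oplus>\<^bsub>V\<^esub> F (bracket L y z) x"
      using xyz ce_diff_2[OF module_V, of L \<rho> f x y z] by (simp add: f F_simps)
    ultimately show ?thesis
      using xyz
      by (simp add: F_simps)
        (rule V.eq_if_same_coefficients, (rule V.represents_intros | simp add: F_simps)+)
  qed
  have R: "?d2 [x, y] =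
      S (F (T x) y \<oplus>\<^bsub>V\<^esub> F x (T y) \<oplus>\<^bsub>V\<^esub> lam \<odot>\<^bsub>V\<^esub> F x y \<oplus>\<^bsub>V\<^esub> \<rho> x (G y) \<ominus>\<^bsub>V\<^esub> \<rho> y (G x))
        \<oplus>\<^bsub>V\<^esub> G (deformed_bracket lam L T x y)
      \<ominus>\<^bsub>V\<^esub> (F (T x) (T y) \<oplus>\<^bsub>V\<^esub> \<rho> (T x) (G y) \<ominus>\<^bsub>V\<^esub> \<rho> (T y) (G x))"
    if xy: "x \<in> carrier L" "y \<in> carrier L" for x y
  proof -
    have phi: "rb_phi K lam L T V S 2 f [x, y] = F (T x) (T y) \<ominus>\<^bsub>V\<^esub>
        (lam \<odot>\<^bsub>V\<^esub> S (F x y) \<oplus>\<^bsub>V\<^esub> S (F (T x) y) \<oplus>\<^bsub>V\<^esub> S (F x (T y)))"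
      using xy rb_phi_2[OF module_V weight_closed, of S L T f x y] by (simp add: f F_simps)
    have diff: "ce_diff K (deformed lam L T) V (deformed_action T V \<rho> S) 1 g [x, y] =
        deformed_action T V \<rho> S x (G y) \<ominus>\<^bsub>V\<^esub> deformed_action T V \<rho> S y (G x)
        \<ominus>\<^bsub>V\<^esub> G (deformed_bracket lam L T x y)"
      using xy ce_diff_1[OF module_V, of "deformed lam L T" "deformed_action T V \<rho> S" g x y]
      by (simp add: deformed_def g G_simps)
    show ?thesis
      using xy weight_closed unfolding phi diff deformed_action_def
      by (simp add: F_simps G_simps)
        (rule V.eq_if_same_coefficients, (rule V.represents_intros | simp add: F_simps G_simps)+)
  qed
  have "?d1 [x, y, z] = \<zero>\<^bsub>V\<^esub> \<longleftrightarrow>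
      \<rho> x (F y z) \<oplus>\<^bsub>V\<^esub> \<rho> y (F z x) \<oplus>\<^bsub>V\<^esub> \<rho> z (F x y)
        \<oplus>\<^bsub>V\<^esub> F x (bracket L y z) \<oplus>\<^bsub>V\<^esub> F y (bracket L z x) \<oplus>\<^bsub>V\<^esub> F z (bracket L x y) = \<zero>\<^bsub>V\<^esub>"
    if "x \<in> carrier L" "y \<in> carrier L" "z \<in> carrier L" for x y z
    unfolding J[OF that] using that by (intro V.add.inv_eq_1_iff) (simp add: F_simps)
  moreover have "?d2 [x, y] = \<zero>\<^bsub>V\<^esub> \<longleftrightarrow>
      F (T x) (T y) \<oplus>\<^bsub>V\<^esub> \<rho> (T x) (G y) \<ominus>\<^bsub>V\<^esub> \<rho> (T y) (G x) =
        S (F (T x) y \<oplus>\<^bsub>V\<^esub> F x (T y) \<oplus>\<^bsub>V\<^esub> lam \<odot>\<^bsub>V\<^esub> F x y \<oplus>\<^bsub>V\<^esub> \<rho> x (G y) \<ominus>\<^bsub>V\<^esub> \<rho> y (G x))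
        \<oplus>\<^bsub>V\<^esub> G (deformed_bracket lam L T x y)"
    if "x \<in> carrier L" "y \<in> carrier L" for x y
    unfolding R[OF that] using that weight_closed
    by (subst V.minus_eq_zero_iff) (auto simp: F_simps G_simps)
  ultimately show ?thesis
    unfolding kernel cocycle_pair_def ball_tuples_2 ball_tuples_3 using F G by (intro iffI conjI ballI) blast+
qed

lemma cocycle_cases:
  assumes "z \<in> rb_cocycles K lam L T V \<rho> S 2"
  obtains F G where "cocycle_pair F G" "z = cochain_of_pair L F G"
proof -
  have "fst z \<in> alt_maps K L V 2" "snd z \<in> alt_maps K L V 1"
    using assms by (auto simp: rb_cocycles_def kernel_def rb_cochains_def alt_group_def numeral_2_eq_2)
  then have "z = cochain_of_pair L (\<lambda>x y. fst z [x, y]) (\<lambda>x. snd z [x])"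
    unfolding cochain_of_pair_def
    by (intro prod_eqI; simp only: fst_conv snd_conv) (erule alt_maps_2_eq alt_maps_1_eq)+
  then show ?thesis
    using that assms cocycle_iff by metis
qed

lemma coboundary_bracket_hom:
  assumes "linear_mod K L V h" "linear_mod K L V k" "x \<in> carrier L" "y \<in> carrier L"
  shows "coboundary_bracket h x y \<in> carrier V"
    and "coboundary_bracket (\<lambda>_. \<zero>\<^bsub>V\<^esub>) x y = \<zero>\<^bsub>V\<^esub>"
    and "coboundary_bracket (\<lambda>x. h x \<oplus>\<^bsub>V\<^esub> k x) x y = coboundary_bracket h x y \<oplus>\<^bsub>V\<^esub> coboundary_bracket k x y"
    and "coboundary_bracket (\<lambda>x. h x \<ominus>\<^bsub>V\<^esub> k x) x y = coboundary_bracket h x y \<ominus>\<^bsub>V\<^esub> coboundary_bracket k x y"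
  unfolding coboundary_bracket_def
  using assms linear_mod_closed[OF assms(1)] linear_mod_closed[OF assms(2)]
  by (simp_all add: V.minus_eq_zero_iff)
    (rule V.eq_if_same_coefficients, (rule V.represents_intros | simp)+)+

lemma coboundary_op_hom:
  assumes "linear_mod K L V h" "linear_mod K L V k" "x \<in> carrier L"
  shows "coboundary_op h x \<in> carrier V"
    and "coboundary_op (\<lambda>_. \<zero>\<^bsub>V\<^esub>) x = \<zero>\<^bsub>V\<^esub>"
    and "coboundary_op (\<lambda>x. h x \<oplus>\<^bsub>V\<^esub> k x) x = coboundary_op h x \<oplus>\<^bsub>V\<^esub> coboundary_op k x"
    and "coboundary_op (\<lambda>x. h x \<ominus>\<^bsub>V\<^esub> k x) x = coboundary_op h x \<ominus>\<^bsub>V\<^esub> coboundary_op k x"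
  unfolding coboundary_op_def
  using assms linear_mod_closed[OF assms(1)] linear_mod_closed[OF assms(2)]
  by (simp_all add: V.minus_eq_zero_iff)
    (rule V.eq_if_same_coefficients, (rule V.represents_intros | simp)+)+

text \<open>The 1-cochain \<open>(f, v)\<close> has the same coboundary as \<open>(h, 0)\<close> with \<open>h x = f x - \<rho> x v\<close>: the map
  \<open>x \<mapsto> \<rho> x v\<close> is, up to sign, the Chevalley-Eilenberg differential of \<open>v\<close> and hence closed, and \<open>-\<rho> (T x) v + S (\<rho> x v)\<close> is the
  deformed differential of \<open>v\<close>.\<close>

lemma coboundaries_eq:
  "rb_coboundaries K lam L T V \<rho> S 2 =
     {cochain_of_pair L (coboundary_bracket h) (coboundary_op h) | h. linear_mod K L V h}"
proof -
  have diff: "rb_diff K lam L T V \<rho> S 1 (f, g) =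
      cochain_of_pair L (coboundary_bracket (\<lambda>x. f [x] \<ominus>\<^bsub>V\<^esub> \<rho> x (g [])))
        (coboundary_op (\<lambda>x. f [x] \<ominus>\<^bsub>V\<^esub> \<rho> x (g [])))"
    if f: "linear_mod K L V (\<lambda>x. f [x])" and g: "g [] \<in> carrier V" for f g
  proof -
    note f_simps = linear_mod_closed[OF f] linear_mod_minus[OF module_L module_V f]
    have "rb_diff K lam L T V \<rho> S 1 (f, g) =
        cochain_of_pair L (\<lambda>x y. ce_diff K L V \<rho> 1 f [x, y])
          (\<lambda>x. \<ominus>\<^bsub>V\<^esub> ce_diff K (deformed lam L T) V (deformed_action T V \<rho> S) 0 g [x]
            \<ominus>\<^bsub>V\<^esub> rb_phi K lam L T V S 1 f [x])"
      unfolding cochain_of_pair_def One_nat_def rb_diff.simps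
      by (auto simp: fun_eq_iff restrict_def ce_diff_def numeral_2_eq_2 tuples_def length_Suc_conv)
    also have "\<dots> = cochain_of_pair L (coboundary_bracket (\<lambda>x. f [x] \<ominus>\<^bsub>V\<^esub> \<rho> x (g [])))
        (coboundary_op (\<lambda>x. f [x] \<ominus>\<^bsub>V\<^esub> \<rho> x (g [])))"
      unfolding cochain_of_pair_eq_iff
    proof (intro conjI ballI)
      fix x y assume xy: "x \<in> carrier L" "y \<in> carrier L"
      have "ce_diff K L V \<rho> 1 f [x, y] = \<rho> x (f [y]) \<ominus>\<^bsub>V\<^esub> \<rho> y (f [x]) \<ominus>\<^bsub>V\<^esub> f [bracket L x y]"
        using xy by (intro ce_diff_1 module_V) (auto simp: f_simps)
      then show "ce_diff K L V \<rho> 1 f [x, y] = coboundary_bracket (\<lambda>x. f [x] \<ominus>\<^bsub>V\<^esub> \<rho> x (g [])) x y"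
        unfolding coboundary_bracket_def using xy g
        by (simp add: f_simps action_bracket)
          (rule V.eq_if_same_coefficients, (rule V.represents_intros | simp add: f_simps)+)
    next
      fix x assume x: "x \<in> carrier L"
      have phi: "rb_phi K lam L T V S 1 f [x] = f [T x] \<ominus>\<^bsub>V\<^esub> S (f [x])"
        using x by (intro rb_phi_1 module_V) (auto simp: f_simps)
      have diff: "ce_diff K (deformed lam L T) V (deformed_action T V \<rho> S) 0 g [x]
          = \<ominus>\<^bsub>V\<^esub> deformed_action T V \<rho> S x (g [])"
        using x g by (intro ce_diff_0 module_V) (auto simp: deformed_def)
      show "\<ominus>\<^bsub>V\<^esub> ce_diff K (deformed lam L T) V (deformed_action T V \<rho> S) 0 g [x]
            \<ominus>\<^bsub>V\<^esub> rb_phi K lam L T V S 1 f [x] = coboundary_op (\<lambda>x. f [x] \<ominus>\<^bsub>V\<^esub> \<rho> x (g [])) x"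
        unfolding phi diff coboundary_op_def deformed_action_def using x g
        by (simp add: f_simps)
          (rule V.eq_if_same_coefficients, (rule V.represents_intros | simp add: f_simps)+)
    qed
    finally show ?thesis .
  qed
  have tuples_0: "tuples L 0 = {[]}"
    by (auto simp: tuples_def)
  have f_linear: "linear_mod K L V (\<lambda>x. f [x])" if "f \<in> alt_maps K L V 1" for f
  proof -
    have "(\<lambda>xs\<in>tuples L 1. f [xs ! 0]) \<in> alt_maps K L V 1"
      using that by (subst alt_maps_1_eq[OF that, symmetric])
    then show ?thesis
      by (rule alt_maps_1_iff[OF module_L, where G = "\<lambda>x. f [x]", THEN iffD1])
  qed
  have B: "rb_coboundaries K lam L T V \<rho> S 2 =
      rb_diff K lam L T V \<rho> S 1 ` (alt_maps K L V 1 \<times> alt_maps K L V 0)"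
    by (simp add: rb_coboundaries_def numeral_2_eq_2 rb_cochains_def alt_group_def)
  show ?thesis
  proof (intro equalityI subsetI)
    fix z assume "z \<in> rb_coboundaries K lam L T V \<rho> S 2"
    then obtain f g where fg: "f \<in> alt_maps K L V 1" "g \<in> alt_maps K L V 0"
        and z: "z = rb_diff K lam L T V \<rho> S 1 (f, g)"
      unfolding B by auto
    have g: "g [] \<in> carrier V"
      using fg(2) by (auto simp: alt_maps_def tuples_0)
    have "linear_mod K L V (\<lambda>x. f [x] \<ominus>\<^bsub>V\<^esub> \<rho> x (g []))"
      by (intro linear_mod_funs module_V f_linear fg action_linear_left g)
    then show "z \<in> {cochain_of_pair L (coboundary_bracket h) (coboundary_op h) | h. linear_mod K L V h}"
      unfolding z diff[of f g, OF f_linear[OF fg(1)] g] by blast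
  next
    fix z assume "z \<in> {cochain_of_pair L (coboundary_bracket h) (coboundary_op h) | h. linear_mod K L V h}"
    then obtain h where h: "linear_mod K L V h"
        and z: "z = cochain_of_pair L (coboundary_bracket h) (coboundary_op h)"
      by blast
    define f where "f = (\<lambda>xs\<in>tuples L 1. h (xs ! 0))"
    define g where "g = (\<lambda>xs\<in>tuples L 0. \<zero>\<^bsub>V\<^esub>)"
    have f: "f \<in> alt_maps K L V 1"
      unfolding f_def by (rule alt_maps_1_iff[OF module_L, THEN iffD2, OF h])
    have "g \<in> alt_maps K L V 0"
      by (auto simp: g_def alt_maps_def tuples_0)
    moreover have "z = rb_diff K lam L T V \<rho> S 1 (f, g)"
    proof -
      have "f [x] \<ominus>\<^bsub>V\<^esub> \<rho> x (g []) = h x" if "x \<in> carrier L" for x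
        using that linear_mod_closed[OF h] by (simp add: f_def g_def tuples_0 mem_tuples_1 V.minus_eq)
      then show ?thesis
        unfolding z by (subst diff[of f g, OF f_linear[OF f]])
          (auto simp: g_def tuples_0 cochain_of_pair_eq_iff coboundary_bracket_def coboundary_op_def)
    qed
    ultimately show "z \<in> rb_coboundaries K lam L T V \<rho> S 2"
      unfolding B using f by blast
  qed
qed

lemma coset_eq:
  "rb_coboundaries K lam L T V \<rho> S 2
     #>\<^bsub>(rb_cochains K L V 2)\<lparr>carrier := rb_cocycles K lam L T V \<rho> S 2\<rparr>\<^esub> cochain_of_pair L F G =
   {cochain_of_pair L (\<lambda>x y. coboundary_bracket h x y \<oplus>\<^bsub>V\<^esub> F x y) (\<lambda>x. coboundary_op h x \<oplus>\<^bsub>V\<^esub> G x)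
     | h. linear_mod K L V h}"
proof -
  have "cochain_of_pair L F1 G1 \<otimes>\<^bsub>rb_cochains K L V 2\<^esub> cochain_of_pair L F2 G2 =
      cochain_of_pair L (\<lambda>x y. F1 x y \<oplus>\<^bsub>V\<^esub> F2 x y) (\<lambda>x. G1 x \<oplus>\<^bsub>V\<^esub> G2 x)" for F1 G1 F2 G2
    by (auto simp: rb_cochains_def numeral_2_eq_2 alt_group_def cochain_of_pair_def DirProd_def fun_eq_iff restrict_def)
  then show ?thesis
    by (auto simp: r_coset_def coboundaries_eq)
qed

definition cohomologous where
  "cohomologous F G F' G' \<longleftrightarrow>
     (\<exists>h. linear_mod K L V h \<and>
        (\<forall>x\<in>carrier L. \<forall>y\<in>carrier L. F' x y = coboundary_bracket h x y \<oplus>\<^bsub>V\<^esub> F x y) \<and>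
        (\<forall>x\<in>carrier L. G' x = coboundary_op h x \<oplus>\<^bsub>V\<^esub> G x))"

abbreviation cohomology_class where
  "cohomology_class z \<equiv> rb_coboundaries K lam L T V \<rho> S 2
     #>\<^bsub>(rb_cochains K L V 2)\<lparr>carrier := rb_cocycles K lam L T V \<rho> S 2\<rparr>\<^esub> z"

lemma cohomology_class_eq_iff:
  assumes "cocycle_pair F G" "cocycle_pair F' G'"
  shows "cohomology_class (cochain_of_pair L F G) = cohomology_class (cochain_of_pair L F' G')
    \<longleftrightarrow> cohomologous F G F' G'"
proof
  have closed: "x \<in> carrier L \<Longrightarrow> y \<in> carrier L \<Longrightarrow> F x y \<in> carrier V"
    "x \<in> carrier L \<Longrightarrow> y \<in> carrier L \<Longrightarrow> F' x y \<in> carrier V"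
    "x \<in> carrier L \<Longrightarrow> G x \<in> carrier V" "x \<in> carrier L \<Longrightarrow> G' x \<in> carrier V" for x y
    using assms by (auto simp: cocycle_pair_def intro: alternating_bilinear_hom(1) linear_mod_closed)
  have zero: "linear_mod K L V (\<lambda>_. \<zero>\<^bsub>V\<^esub>)"
    by (intro linear_mod_funs module_V)
  {
    assume eq: "cohomology_class (cochain_of_pair L F G) = cohomology_class (cochain_of_pair L F' G')"
    have "cochain_of_pair L F' G' = cochain_of_pair L
        (\<lambda>x y. coboundary_bracket (\<lambda>_. \<zero>\<^bsub>V\<^esub>) x y \<oplus>\<^bsub>V\<^esub> F' x y)
        (\<lambda>x. coboundary_op (\<lambda>_. \<zero>\<^bsub>V\<^esub>) x \<oplus>\<^bsub>V\<^esub> G' x)"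
      using closed by (simp add: cochain_of_pair_eq_iff coboundary_bracket_hom(2)[OF zero zero] coboundary_op_hom(2)[OF zero zero])
    then have "cochain_of_pair L F' G' \<in> cohomology_class (cochain_of_pair L F' G')"
      unfolding coset_eq using zero by blast
    then have "cochain_of_pair L F' G' \<in> cohomology_class (cochain_of_pair L F G)"
      by (simp only: eq)
    then show "cohomologous F G F' G'"
      unfolding coset_eq cohomologous_def by (auto simp: cochain_of_pair_eq_iff)
  }
  assume "cohomologous F G F' G'"
  then obtain h where h: "linear_mod K L V h"
      and F': "\<And>x y. x \<in> carrier L \<Longrightarrow> y \<in> carrier L \<Longrightarrow> F' x y = coboundary_bracket h x y \<oplus>\<^bsub>V\<^esub> F x y"
      and G': "\<And>x. x \<in> carrier L \<Longrightarrow> G' x = coboundary_op h x \<oplus>\<^bsub>V\<^esub> G x"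
    by (auto simp: cohomologous_def)
  have shift: "cochain_of_pair L (\<lambda>x y. coboundary_bracket k x y \<oplus>\<^bsub>V\<^esub> F' x y) (\<lambda>x. coboundary_op k x \<oplus>\<^bsub>V\<^esub> G' x)
      = cochain_of_pair L (\<lambda>x y. coboundary_bracket (\<lambda>x. k x \<oplus>\<^bsub>V\<^esub> h x) x y \<oplus>\<^bsub>V\<^esub> F x y)
          (\<lambda>x. coboundary_op (\<lambda>x. k x \<oplus>\<^bsub>V\<^esub> h x) x \<oplus>\<^bsub>V\<^esub> G x)" if k: "linear_mod K L V k" for k
    using closed coboundary_bracket_hom[OF k h] coboundary_bracket_hom(1)[OF h k]
      coboundary_op_hom[OF k h] coboundary_op_hom(1)[OF h k]
    by (auto simp: cochain_of_pair_eq_iff F' G' V.a_assoc)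
  have unshift: "cochain_of_pair L (\<lambda>x y. coboundary_bracket k x y \<oplus>\<^bsub>V\<^esub> F x y) (\<lambda>x. coboundary_op k x \<oplus>\<^bsub>V\<^esub> G x)
      = cochain_of_pair L (\<lambda>x y. coboundary_bracket (\<lambda>x. k x \<ominus>\<^bsub>V\<^esub> h x) x y \<oplus>\<^bsub>V\<^esub> F' x y)
          (\<lambda>x. coboundary_op (\<lambda>x. k x \<ominus>\<^bsub>V\<^esub> h x) x \<oplus>\<^bsub>V\<^esub> G' x)" if k: "linear_mod K L V k" for k
    unfolding cochain_of_pair_eq_iff
    using closed coboundary_bracket_hom[OF k h] coboundary_bracket_hom(1)[OF h k]
      coboundary_op_hom[OF k h] coboundary_op_hom(1)[OF h k]
    by (intro conjI ballI)
      (simp add: F' G', rule V.eq_if_same_coefficients, (rule V.represents_intros | simp)+)+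
  show "cohomology_class (cochain_of_pair L F G) = cohomology_class (cochain_of_pair L F' G')"
    unfolding coset_eq
  proof (intro equalityI subsetI)
    fix z assume "z \<in> {cochain_of_pair L (\<lambda>x y. coboundary_bracket k x y \<oplus>\<^bsub>V\<^esub> F x y)
        (\<lambda>x. coboundary_op k x \<oplus>\<^bsub>V\<^esub> G x) | k. linear_mod K L V k}"
    then show "z \<in> {cochain_of_pair L (\<lambda>x y. coboundary_bracket k x y \<oplus>\<^bsub>V\<^esub> F' x y)
        (\<lambda>x. coboundary_op k x \<oplus>\<^bsub>V\<^esub> G' x) | k. linear_mod K L V k}"
      using unshift linear_mod_minus_fun[OF module_V _ h] by blast
  next
    fix z assume "z \<in> {cochain_of_pair L (\<lambda>x y. coboundary_bracket k x y \<oplus>\<^bsub>V\<^esub> F' x y)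
        (\<lambda>x. coboundary_op k x \<oplus>\<^bsub>V\<^esub> G' x) | k. linear_mod K L V k}"
    then show "z \<in> {cochain_of_pair L (\<lambda>x y. coboundary_bracket k x y \<oplus>\<^bsub>V\<^esub> F x y)
        (\<lambda>x. coboundary_op k x \<oplus>\<^bsub>V\<^esub> G x) | k. linear_mod K L V k}"
      using shift linear_mod_add_fun[OF module_V _ h] by blast
  qed
qed

end

section \<open>Abelian extensions\<close>

lemma linear_mod_abelian_lie [simp]: "linear_mod K (abelian_lie V) N f \<longleftrightarrow> linear_mod K V N f"
  by (simp add: linear_mod_def abelian_lie_def)

lemma abelian_lie_simps [simp]:
  "carrier (abelian_lie V) = carrier V" "bracket (abelian_lie V) u v = \<zero>\<^bsub>V\<^esub>"
  by (simp_all add: abelian_lie_def)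

locale abelian_extension_of = rb_representation K lam L T V \<rho> S
  for K (structure) and lam and L (structure) and T and V (structure) and \<rho> and S +
  fixes E
  assumes extension: "abelian_extension K lam L T V S E"

sublocale abelian_extension_of \<subseteq> E: rota_baxter_lie K lam "mid E" "mid_op E"
  using extension by (simp add: abelian_extension_def)

context abelian_extension_of
begin

abbreviation "incl \<equiv> inclusion E"
abbreviation "proj \<equiv> projection E"
abbreviation "pre \<equiv> inv_into (carrier V) (inclusion E)"

lemma inclusion_linear: "linear_mod K V (mid E) incl"
  and projection_linear: "linear_mod K (mid E) L proj"
  using extension by (simp_all add: abelian_extension_def rb_morphism_def)

lemmas inclusion_hom [simp] =
  linear_mod_hom(1-3)[OF inclusion_linear]
  linear_mod_hom(4-)[OF module_V E.module_L inclusion_linear]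

lemmas projection_hom [simp] =
  linear_mod_hom(1-3)[OF projection_linear]
  linear_mod_hom(4-)[OF E.module_L module_L projection_linear]

lemma
  shows projection_bracket [simp]: "d \<in> carrier (mid E) \<Longrightarrow> e \<in> carrier (mid E) \<Longrightarrow>
      proj (bracket (mid E) d e) = bracket L (proj d) (proj e)"
    and projection_op [simp]: "e \<in> carrier (mid E) \<Longrightarrow> proj (mid_op E e) = T (proj e)"
    and inclusion_op [simp]: "u \<in> carrier V \<Longrightarrow> mid_op E (incl u) = incl (S u)"
    and projection_inclusion [simp]: "u \<in> carrier V \<Longrightarrow> proj (incl u) = \<zero>\<^bsub>L\<^esub>"
    and inclusion_eq_iff [simp]: "u \<in> carrier V \<Longrightarrow> v \<in> carrier V \<Longrightarrow> incl u = incl v \<longleftrightarrow> u = v"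
  using extension by (auto simp: abelian_extension_def rb_morphism_def inj_on_def)

lemma inclusion_injD: "incl u = incl v \<Longrightarrow> u \<in> carrier V \<Longrightarrow> v \<in> carrier V \<Longrightarrow> u = v"
  by simp

lemma bracket_inclusion [simp]:
  assumes "u \<in> carrier V" "v \<in> carrier V"
  shows "bracket (mid E) (incl u) (incl v) = \<zero>\<^bsub>mid E\<^esub>"
proof -
  have "\<forall>u\<in>carrier V. \<forall>v\<in>carrier V. incl \<zero>\<^bsub>V\<^esub> = bracket (mid E) (incl u) (incl v)"
    using extension[unfolded abelian_extension_def rb_morphism_def abelian_lie_simps] by blast
  then show ?thesis
    using assms by (metis inclusion_hom(4))
qed

lemma
  assumes "e \<in> carrier (mid E)" "proj e = \<zero>\<^bsub>L\<^esub>"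
  shows pre_closed: "pre e \<in> carrier V" and inclusion_pre: "incl (pre e) = e"
proof -
  have "e \<in> incl ` carrier V"
    using extension assms by (simp add: abelian_extension_def)
  then show "pre e \<in> carrier V" "incl (pre e) = e"
    by (auto intro: inv_into_into f_inv_into_f)
qed

lemma pre_inclusion [simp]: "u \<in> carrier V \<Longrightarrow> pre (incl u) = u"
  using extension by (simp add: abelian_extension_def)

lemma section_exists: "\<exists>s. linear_section K L E s"
  unfolding linear_section_def
  using extension
  by (intro linear_section_exists field_axioms E.module_L module_L projection_linear)
    (simp add: abelian_extension_def)

text \<open>The induced action can be read off without a section: any \<open>e\<close> differs from \<open>s (proj e)\<close> by an element
  of \<open>V\<close>, and brackets of elements of \<open>V\<close> vanish, so \<open>[e, u]\<close> depends on \<open>proj e\<close> only.  The existence of a section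
  is what makes the implication from left to right more than vacuous.\<close>

lemma inducing_iff:
  "E \<in> extensions_inducing K lam L T V \<rho> S \<longleftrightarrow>
     (\<forall>e\<in>carrier (mid E). \<forall>u\<in>carrier V. bracket (mid E) e (incl u) = incl (\<rho> (proj e) u))"
proof
  assume ind: "E \<in> extensions_inducing K lam L T V \<rho> S"
  obtain s where s: "linear_section K L E s"
    using section_exists by blast
  then have s_linear: "linear_mod K L (mid E) s" and s_proj: "\<And>x. x \<in> carrier L \<Longrightarrow> proj (s x) = x"
    by (auto simp: linear_section_def)
  note s_closed = linear_mod_closed[OF s_linear]
  show "\<forall>e\<in>carrier (mid E). \<forall>u\<in>carrier V. bracket (mid E) e (incl u) = incl (\<rho> (proj e) u)"
  proof (intro ballI)
    fix e u assume eu: "e \<in> carrier (mid E)" "u \<in> carrier V"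
    let ?x = "proj e" and ?d = "e \<ominus>\<^bsub>mid E\<^esub> s (proj e)"
    have d: "?d \<in> carrier (mid E)" "proj ?d = \<zero>\<^bsub>L\<^esub>"
      using eu by (simp_all add: s_closed s_proj minus_eq_zero_iff)
    have "e = s ?x \<oplus>\<^bsub>mid E\<^esub> ?d"
      by (rule E.eq_if_same_coefficients, (rule E.represents_intros | simp add: s_closed eu)+)
    then have "bracket (mid E) e (incl u)
        = bracket (mid E) (s ?x \<oplus>\<^bsub>mid E\<^esub> incl (pre ?d)) (incl u)"
      using inclusion_pre[OF d] by simp
    also have "\<dots> = bracket (mid E) (s ?x) (incl u)"
      using eu pre_closed[OF d] by (simp add: s_closed)
    also have "\<dots> = incl (pre (bracket (mid E) (s ?x) (incl u)))"
      using eu by (intro inclusion_pre[symmetric]) (simp_all add: s_closed)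
    also have "pre (bracket (mid E) (s ?x) (incl u)) = \<rho> ?x u"
      using ind s eu by (simp add: extensions_inducing_def induced_action_def)
    finally show "bracket (mid E) e (incl u) = incl (\<rho> (proj e) u)" .
  qed
next
  assume ind: "\<forall>e\<in>carrier (mid E). \<forall>u\<in>carrier V. bracket (mid E) e (incl u) = incl (\<rho> (proj e) u)"
  have "induced_action V E s x u = \<rho> x u"
    if "linear_section K L E s" "x \<in> carrier L" "u \<in> carrier V" for s x u
    using that ind linear_mod_closed[of K L "mid E" s x]
    by (auto simp: induced_action_def linear_section_def)
  then show "E \<in> extensions_inducing K lam L T V \<rho> S"
    using extension by (simp add: extensions_inducing_def)
qed

end

text \<open>Both differences lie in the kernel of the projection, which is the image of \<open>V\<close>, so that \<open>inv_into\<close>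
  makes sense.\<close>

definition bracket_defect where
  "bracket_defect L V E s x y = inv_into (carrier V) (inclusion E)
     (bracket (mid E) (s x) (s y) \<ominus>\<^bsub>mid E\<^esub> s (bracket L x y))"

definition op_defect where
  "op_defect T V E s x = inv_into (carrier V) (inclusion E) (mid_op E (s x) \<ominus>\<^bsub>mid E\<^esub> s (T x))"

locale extension_with_section = abelian_extension_of K lam L T V \<rho> S E
  for K (structure) and lam and L (structure) and T and V (structure) and \<rho> and S and E +
  fixes s
  assumes inducing: "E \<in> extensions_inducing K lam L T V \<rho> S"
    and is_section: "linear_section K L E s"
begin

lemma action_eq [simp]:
  "e \<in> carrier (mid E) \<Longrightarrow> u \<in> carrier V \<Longrightarrow> bracket (mid E) e (incl u) = incl (\<rho> (proj e) u)"
  using inducing inducing_iff by blast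

lemma action_eq' [simp]:
  "e \<in> carrier (mid E) \<Longrightarrow> u \<in> carrier V \<Longrightarrow> bracket (mid E) (incl u) e = \<ominus>\<^bsub>mid E\<^esub> incl (\<rho> (proj e) u)"
  using E.bracket_skew[of "incl u" e] by simp

lemma section_linear: "linear_mod K L (mid E) s"
  and projection_section [simp]: "x \<in> carrier L \<Longrightarrow> proj (s x) = x"
  using is_section by (auto simp: linear_section_def)

lemmas section_hom [simp] =
  linear_mod_hom(1-3)[OF section_linear]
  linear_mod_hom(4-)[OF module_L E.module_L section_linear]

abbreviation "F \<equiv> bracket_defect L V E s"
abbreviation "G \<equiv> op_defect T V E s"

lemma bracket_defect_closed [simp]: "x \<in> carrier L \<Longrightarrow> y \<in> carrier L \<Longrightarrow> F x y \<in> carrier V"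
  and inclusion_bracket_defect: "x \<in> carrier L \<Longrightarrow> y \<in> carrier L \<Longrightarrow>
      incl (F x y) = bracket (mid E) (s x) (s y) \<ominus>\<^bsub>mid E\<^esub> s (bracket L x y)"
  unfolding bracket_defect_def
  by (intro pre_closed inclusion_pre; simp add: minus_eq_zero_iff)+

lemma op_defect_closed [simp]: "x \<in> carrier L \<Longrightarrow> G x \<in> carrier V"
  and inclusion_op_defect: "x \<in> carrier L \<Longrightarrow> incl (G x) = mid_op E (s x) \<ominus>\<^bsub>mid E\<^esub> s (T x)"
  unfolding op_defect_def
  by (intro pre_closed inclusion_pre; simp add: minus_eq_zero_iff)+

lemma bracket_section:
  assumes "x \<in> carrier L" "y \<in> carrier L"
  shows "bracket (mid E) (s x) (s y) = s (bracket L x y) \<oplus>\<^bsub>mid E\<^esub> incl (F x y)"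
  unfolding inclusion_bracket_defect[OF assms]
  by (rule E.eq_if_same_coefficients, (rule E.represents_intros | simp add: assms)+)

lemma op_section:
  assumes "x \<in> carrier L"
  shows "mid_op E (s x) = s (T x) \<oplus>\<^bsub>mid E\<^esub> incl (G x)"
  unfolding inclusion_op_defect[OF assms]
  by (rule E.eq_if_same_coefficients, (rule E.represents_intros | simp add: assms)+)

lemma bracket_decomposed:
  assumes "x \<in> carrier L" "y \<in> carrier L" "u \<in> carrier V" "v \<in> carrier V"
  shows "bracket (mid E) (s x \<oplus>\<^bsub>mid E\<^esub> incl u) (s y \<oplus>\<^bsub>mid E\<^esub> incl v) =
    s (bracket L x y) \<oplus>\<^bsub>mid E\<^esub> incl (F x y \<oplus>\<^bsub>V\<^esub> \<rho> x v \<ominus>\<^bsub>V\<^esub> \<rho> y u)"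
  using assms
  by (simp add: bracket_section)
    (rule E.eq_if_same_coefficients, (rule E.represents_intros | simp)+)

lemma op_decomposed:
  assumes "x \<in> carrier L" "u \<in> carrier V"
  shows "mid_op E (s x \<oplus>\<^bsub>mid E\<^esub> incl u) = s (T x) \<oplus>\<^bsub>mid E\<^esub> incl (G x \<oplus>\<^bsub>V\<^esub> S u)"
  using assms by (simp add: op_section E.a_assoc)

text \<open>The \<open>V\<close>-component of \<open>e\<close> in the decomposition of the middle algebra defined by the section.\<close>

definition coordinate where "coordinate e = pre (e \<ominus>\<^bsub>mid E\<^esub> s (proj e))"

lemma
  assumes "e \<in> carrier (mid E)"
  shows coordinate_closed [simp]: "coordinate e \<in> carrier V"
    and inclusion_coordinate: "incl (coordinate e) = e \<ominus>\<^bsub>mid E\<^esub> s (proj e)"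
  unfolding coordinate_def using assms
  by (intro pre_closed inclusion_pre; simp add: minus_eq_zero_iff)+

lemma decomposition:
  assumes "e \<in> carrier (mid E)"
  shows "e = s (proj e) \<oplus>\<^bsub>mid E\<^esub> incl (coordinate e)"
  unfolding inclusion_coordinate[OF assms]
  by (rule E.eq_if_same_coefficients, (rule E.represents_intros | simp add: assms)+)

lemma coordinate_decomposed [simp]:
  assumes "x \<in> carrier L" "u \<in> carrier V"
  shows "coordinate (s x \<oplus>\<^bsub>mid E\<^esub> incl u) = u"
proof -
  have "s x \<oplus>\<^bsub>mid E\<^esub> incl u \<ominus>\<^bsub>mid E\<^esub> s x = incl u"
    by (rule E.eq_if_same_coefficients, (rule E.represents_intros | simp add: assms)+)
  then show ?thesis
    using assms by (simp add: coordinate_def)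
qed

lemma coordinate_linear: "linear_mod K (mid E) V coordinate"
proof -
  have "coordinate (d \<oplus>\<^bsub>mid E\<^esub> e) = coordinate d \<oplus>\<^bsub>V\<^esub> coordinate e"
    if de: "d \<in> carrier (mid E)" "e \<in> carrier (mid E)" for d e
  proof -
    have "incl (coordinate (d \<oplus>\<^bsub>mid E\<^esub> e)) = incl (coordinate d \<oplus>\<^bsub>V\<^esub> coordinate e)"
      using de
      by (simp add: inclusion_coordinate)
        (rule E.eq_if_same_coefficients, (rule E.represents_intros | simp)+)
    then show ?thesis
      by (rule inclusion_injD) (use de in simp_all)
  qed
  moreover have "coordinate (a \<odot>\<^bsub>mid E\<^esub> e) = a \<odot>\<^bsub>V\<^esub> coordinate e"
    if ae: "a \<in> carrier K" "e \<in> carrier (mid E)" for a e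
  proof -
    have "incl (coordinate (a \<odot>\<^bsub>mid E\<^esub> e)) = incl (a \<odot>\<^bsub>V\<^esub> coordinate e)"
      using ae by (simp add: inclusion_coordinate E.minus_eq E.smult_r_distr E.smult_r_minus)
    then show ?thesis
      by (rule inclusion_injD) (use ae in simp_all)
  qed
  ultimately show ?thesis
    by (auto simp: linear_mod_def)
qed

text \<open>Since the decomposition is unique, an equation of this shape determines the defect.\<close>

lemma bracket_defect_eqI:
  "x \<in> carrier L \<Longrightarrow> y \<in> carrier L \<Longrightarrow> u \<in> carrier V \<Longrightarrow>
   bracket (mid E) (s x) (s y) = s (bracket L x y) \<oplus>\<^bsub>mid E\<^esub> incl u \<Longrightarrow> F x y = u"
  using coordinate_decomposed[of "bracket L x y" u] coordinate_decomposed[of "bracket L x y" "F x y"]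
  by (simp add: bracket_section)

lemma op_defect_eqI:
  "x \<in> carrier L \<Longrightarrow> u \<in> carrier V \<Longrightarrow> mid_op E (s x) = s (T x) \<oplus>\<^bsub>mid E\<^esub> incl u \<Longrightarrow> G x = u"
  using coordinate_decomposed[of "T x" u] coordinate_decomposed[of "T x" "G x"]
  by (simp add: op_section)

lemma bracket_defect_alternating: "alternating_bilinear K L V F"
proof -
  have "F (x \<oplus>\<^bsub>L\<^esub> y) z = F x z \<oplus>\<^bsub>V\<^esub> F y z" "F z (x \<oplus>\<^bsub>L\<^esub> y) = F z x \<oplus>\<^bsub>V\<^esub> F z y"
    if "x \<in> carrier L" "y \<in> carrier L" "z \<in> carrier L" for x y z
    using that
    by (intro bracket_defect_eqI;
        simp add: bracket_section E.a_ac)+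
  moreover have "F (a \<odot>\<^bsub>L\<^esub> x) z = a \<odot>\<^bsub>V\<^esub> F x z" "F z (a \<odot>\<^bsub>L\<^esub> x) = a \<odot>\<^bsub>V\<^esub> F z x"
    if "a \<in> carrier K" "x \<in> carrier L" "z \<in> carrier L" for a x z
    using that by (intro bracket_defect_eqI; simp add: bracket_section E.smult_r_distr)+
  moreover have "F x x = \<zero>\<^bsub>V\<^esub>" if "x \<in> carrier L" for x
    using that by (intro bracket_defect_eqI) (simp_all add: E.bracket_alternating bracket_alternating)
  ultimately show ?thesis
    by (auto simp: alternating_bilinear_def linear_mod_def)
qed

lemma op_defect_linear: "linear_mod K L V G"
proof -
  have "G (x \<oplus>\<^bsub>L\<^esub> y) = G x \<oplus>\<^bsub>V\<^esub> G y" if "x \<in> carrier L" "y \<in> carrier L" for x y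
    using that by (intro op_defect_eqI) (simp_all add: op_section E.a_ac)
  moreover have "G (a \<odot>\<^bsub>L\<^esub> x) = a \<odot>\<^bsub>V\<^esub> G x" if "a \<in> carrier K" "x \<in> carrier L" for a x
    using that by (intro op_defect_eqI) (simp_all add: op_section E.smult_r_distr)
  ultimately show ?thesis
    by (auto simp: linear_mod_def)
qed

text \<open>Both cocycle equations are \<open>V\<close>-components of identities in the middle algebra, taken at elements of
  the form \<open>s x\<close>; their \<open>L\<close>-components are the corresponding identities in \<open>L\<close>.\<close>

lemma defects_cocycle: "cocycle_pair F G"
proof -
  have "\<rho> x (F y z) \<oplus>\<^bsub>V\<^esub> \<rho> y (F z x) \<oplus>\<^bsub>V\<^esub> \<rho> z (F x y)
      \<oplus>\<^bsub>V\<^esub> F x (bracket L y z) \<oplus>\<^bsub>V\<^esub> F y (bracket L z x) \<oplus>\<^bsub>V\<^esub> F z (bracket L x y) = \<zero>\<^bsub>V\<^esub>" (is "?J = _")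
    if xyz: "x \<in> carrier L" "y \<in> carrier L" "z \<in> carrier L" for x y z
  proof -
    have nested: "bracket (mid E) (s x) (bracket (mid E) (s y) (s z)) =
        s (bracket L x (bracket L y z)) \<oplus>\<^bsub>mid E\<^esub> incl (F x (bracket L y z) \<oplus>\<^bsub>V\<^esub> \<rho> x (F y z))"
      if "x \<in> carrier L" "y \<in> carrier L" "z \<in> carrier L" for x y z
      using that by (simp add: bracket_section E.a_assoc)
    \<comment> \<open>Adding the image under \<open>s\<close> of the Jacobi sum in \<open>L\<close>, which is zero, completes \<open>incl ?J\<close> to the
      Jacobi sum of \<open>s x\<close>, \<open>s y\<close>, \<open>s z\<close>.\<close>
    have "incl ?J = s (bracket L x (bracket L y z) \<oplus>\<^bsub>L\<^esub> bracket L y (bracket L z x)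
        \<oplus>\<^bsub>L\<^esub> bracket L z (bracket L x y)) \<oplus>\<^bsub>mid E\<^esub> incl ?J"
      using xyz by (subst jacobi) simp_all
    also have "\<dots> = bracket (mid E) (s x) (bracket (mid E) (s y) (s z))
        \<oplus>\<^bsub>mid E\<^esub> bracket (mid E) (s y) (bracket (mid E) (s z) (s x))
        \<oplus>\<^bsub>mid E\<^esub> bracket (mid E) (s z) (bracket (mid E) (s x) (s y))"
      using xyz unfolding nested[OF xyz] nested[OF xyz(2,3,1)] nested[OF xyz(3,1,2)]
      by simp (rule E.eq_if_same_coefficients, (rule E.represents_intros | simp)+)
    also have "\<dots> = incl \<zero>\<^bsub>V\<^esub>"
      using xyz by (subst E.jacobi) simp_all
    finally show ?thesis
      by (rule inclusion_injD) (use xyz in simp_all)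
  qed
  moreover have "F (T x) (T y) \<oplus>\<^bsub>V\<^esub> \<rho> (T x) (G y) \<ominus>\<^bsub>V\<^esub> \<rho> (T y) (G x) =
      S (F (T x) y \<oplus>\<^bsub>V\<^esub> F x (T y) \<oplus>\<^bsub>V\<^esub> lam \<odot>\<^bsub>V\<^esub> F x y \<oplus>\<^bsub>V\<^esub> \<rho> x (G y) \<ominus>\<^bsub>V\<^esub> \<rho> y (G x))
        \<oplus>\<^bsub>V\<^esub> G (deformed_bracket lam L T x y)" (is "?A = S ?W \<oplus>\<^bsub>V\<^esub> _")
    if xy: "x \<in> carrier L" "y \<in> carrier L" for x y
  proof -
    have W: "?W \<in> carrier V" and A: "?A \<in> carrier V"
      using xy weight_closed by simp_all
    have "deformed_bracket lam (mid E) (mid_op E) (s x) (s y) =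
        s (deformed_bracket lam L T x y) \<oplus>\<^bsub>mid E\<^esub> incl ?W"
      using xy weight_closed
      by (simp add: deformed_bracket_def op_section bracket_section E.smult_r_distr)
        (rule E.eq_if_same_coefficients, (rule E.represents_intros | simp)+)
    then have "mid_op E (deformed_bracket lam (mid E) (mid_op E) (s x) (s y)) =
        s (T (deformed_bracket lam L T x y)) \<oplus>\<^bsub>mid E\<^esub> incl (G (deformed_bracket lam L T x y) \<oplus>\<^bsub>V\<^esub> S ?W)"
      using op_decomposed[OF _ W, of "deformed_bracket lam L T x y"] xy by simp
    moreover have "bracket (mid E) (mid_op E (s x)) (mid_op E (s y)) =
        s (bracket L (T x) (T y)) \<oplus>\<^bsub>mid E\<^esub> incl ?A"
      using xy bracket_decomposed[of "T x" "T y" "G x" "G y"] by (simp add: op_section)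
    ultimately have "s (bracket L (T x) (T y)) \<oplus>\<^bsub>mid E\<^esub> incl ?A =
        s (bracket L (T x) (T y)) \<oplus>\<^bsub>mid E\<^esub> incl (G (deformed_bracket lam L T x y) \<oplus>\<^bsub>V\<^esub> S ?W)"
      using xy rota_baxter[OF xy] E.rota_baxter[of "s x" "s y"] by simp
    then have "coordinate (s (bracket L (T x) (T y)) \<oplus>\<^bsub>mid E\<^esub> incl ?A) =
        coordinate (s (bracket L (T x) (T y)) \<oplus>\<^bsub>mid E\<^esub> incl (G (deformed_bracket lam L T x y) \<oplus>\<^bsub>V\<^esub> S ?W))"
      by (simp only:)
    then have "?A = G (deformed_bracket lam L T x y) \<oplus>\<^bsub>V\<^esub> S ?W"
      using xy A W by (subst (asm) (1 2) coordinate_decomposed) simp_all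
    then show ?thesis
      using xy W by (simp add: V.a_comm del: rep_op_hom(2-))
  qed
  ultimately show ?thesis
    using bracket_defect_alternating op_defect_linear by (simp add: cocycle_pair_def)
qed

lemma shifted_section:
  assumes h: "linear_mod K L V h"
  defines "s' \<equiv> \<lambda>x. s x \<oplus>\<^bsub>mid E\<^esub> incl (h x)"
  shows "linear_section K L E s'"
    and "x \<in> carrier L \<Longrightarrow> y \<in> carrier L \<Longrightarrow>
      bracket_defect L V E s' x y = coboundary_bracket h x y \<oplus>\<^bsub>V\<^esub> F x y"
    and "x \<in> carrier L \<Longrightarrow> op_defect T V E s' x = coboundary_op h x \<oplus>\<^bsub>V\<^esub> G x"
proof -
  note h_closed [simp] = linear_mod_closed[OF h]
  show sec: "linear_section K L E s'"
    unfolding linear_section_def s'_def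
    using linear_mod_add_fun[OF E.module_L section_linear linear_mod_compose[OF h inclusion_linear]]
    by simp
  interpret s': extension_with_section K lam L T V \<rho> S E s'
    by unfold_locales (fact inducing sec)+
  {
    assume "x \<in> carrier L" "y \<in> carrier L"
    then show "bracket_defect L V E s' x y = coboundary_bracket h x y \<oplus>\<^bsub>V\<^esub> F x y"
      by (intro s'.bracket_defect_eqI; simp add: s'_def bracket_decomposed bracket_section coboundary_bracket_def)
        (rule E.eq_if_same_coefficients, (rule E.represents_intros | simp)+)
  next
    assume "x \<in> carrier L"
    then show "op_defect T V E s' x = coboundary_op h x \<oplus>\<^bsub>V\<^esub> G x"
      by (intro s'.op_defect_eqI; simp add: s'_def op_decomposed op_section coboundary_op_def)
        (rule E.eq_if_same_coefficients, (rule E.represents_intros | simp)+)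
  }
qed

lemma bracket_defect_cong:
  "(\<And>x. x \<in> carrier L \<Longrightarrow> s1 x = s2 x) \<Longrightarrow> x \<in> carrier L \<Longrightarrow> y \<in> carrier L \<Longrightarrow>
    bracket_defect L V E s1 x y = bracket_defect L V E s2 x y"
  by (simp add: bracket_defect_def)

lemma op_defect_cong:
  "(\<And>x. x \<in> carrier L \<Longrightarrow> s1 x = s2 x) \<Longrightarrow> x \<in> carrier L \<Longrightarrow>
    op_defect T V E s1 x = op_defect T V E s2 x"
  by (simp add: op_defect_def)

text \<open>The difference of two sections takes values in the kernel of the projection, so the second section is
  the first one shifted by its own \<open>V\<close>-coordinate.\<close>

lemma sections_cohomologous:
  assumes "linear_section K L E s2"
  shows "cohomologous F G (bracket_defect L V E s2) (op_defect T V E s2)"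
proof -
  have s2: "linear_mod K L (mid E) s2" "\<And>x. x \<in> carrier L \<Longrightarrow> proj (s2 x) = x"
    using assms by (auto simp: linear_section_def)
  define h where "h = (\<lambda>x. coordinate (s2 x))"
  have h: "linear_mod K L V h"
    unfolding h_def by (rule linear_mod_compose[OF s2(1) coordinate_linear])
  have "s2 x = s x \<oplus>\<^bsub>mid E\<^esub> incl (h x)" if "x \<in> carrier L" for x
    using decomposition[of "s2 x"] that linear_mod_closed[OF s2(1)] s2(2) by (simp add: h_def)
  then show ?thesis
    unfolding cohomologous_def
    using h shifted_section(2,3)[OF h]
      bracket_defect_cong[of s2 "\<lambda>x. s x \<oplus>\<^bsub>mid E\<^esub> incl (h x)"]
      op_defect_cong[of s2 "\<lambda>x. s x \<oplus>\<^bsub>mid E\<^esub> incl (h x)"]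
    by (intro exI[of _ h]) simp
qed

end

section \<open>Isomorphic extensions\<close>

text \<open>The isomorphism is \<open>s x + i u \<mapsto> s' x + i' u\<close>.  By \<open>bracket_decomposed\<close> and \<open>op_decomposed\<close>, bracket and
  operator are given by the same formulas on both sides.\<close>

lemma extension_iso_if_equal_defects:
  assumes "extension_with_section K lam L T V \<rho> S E s" "extension_with_section K lam L T V \<rho> S E' s'"
    and F: "\<And>x y. x \<in> carrier L \<Longrightarrow> y \<in> carrier L \<Longrightarrow>
      bracket_defect L V E s x y = bracket_defect L V E' s' x y"
    and G: "\<And>x. x \<in> carrier L \<Longrightarrow> op_defect T V E s x = op_defect T V E' s' x"
  shows "extension_iso K V E E'"
proof -
  interpret A: extension_with_section K lam L T V \<rho> S E s by fact
  interpret B: extension_with_section K lam L T V \<rho> S E' s' by fact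
  define \<phi> where "\<phi> = (\<lambda>e. s' (projection E e) \<oplus>\<^bsub>mid E'\<^esub> inclusion E' (A.coordinate e))"
  have linear: "linear_mod K (mid E) (mid E') \<phi>"
    unfolding \<phi>_def
    by (intro linear_mod_add_fun B.E.module_L linear_mod_compose[OF A.projection_linear B.section_linear]
        linear_mod_compose[OF A.coordinate_linear B.inclusion_linear])
  have \<phi>: "\<phi> (s x \<oplus>\<^bsub>mid E\<^esub> inclusion E u) = s' x \<oplus>\<^bsub>mid E'\<^esub> inclusion E' u"
    if "x \<in> carrier L" "u \<in> carrier V" for x u
    using that by (simp add: \<phi>_def)
  have decomposed: "\<exists>x u. x \<in> carrier L \<and> u \<in> carrier V \<and> e = s x \<oplus>\<^bsub>mid E\<^esub> inclusion E u"
    if "e \<in> carrier (mid E)" for e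
    using A.decomposition[OF that] that A.coordinate_closed A.projection_hom(1) by blast
  have "\<phi> (bracket (mid E) d e) = bracket (mid E') (\<phi> d) (\<phi> e)"
    if de: "d \<in> carrier (mid E)" "e \<in> carrier (mid E)" for d e
  proof -
    obtain x u y v where *: "x \<in> carrier L" "u \<in> carrier V" "d = s x \<oplus>\<^bsub>mid E\<^esub> inclusion E u"
        "y \<in> carrier L" "v \<in> carrier V" "e = s y \<oplus>\<^bsub>mid E\<^esub> inclusion E v"
      using decomposed[OF de(1)] decomposed[OF de(2)] by blast
    then show ?thesis
      unfolding *(3,6) by (subst A.bracket_decomposed) (simp_all only: \<phi> B.bracket_decomposed F
          A.bracket_hom(1) A.V.a_closed A.V.minus_closed A.action_hom(1) B.bracket_defect_closed)
  qed
  moreover have "\<phi> (mid_op E e) = mid_op E' (\<phi> e)" if e: "e \<in> carrier (mid E)" for e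
  proof -
    obtain x u where *: "x \<in> carrier L" "u \<in> carrier V" "e = s x \<oplus>\<^bsub>mid E\<^esub> inclusion E u"
      using decomposed[OF e] by blast
    then show ?thesis
      unfolding *(3) by (subst A.op_decomposed) (simp_all only: \<phi> B.op_decomposed G
          A.op_hom(1) A.V.a_closed A.rep_op_hom(1) B.op_defect_closed)
  qed
  moreover have "bij_betw \<phi> (carrier (mid E)) (carrier (mid E'))"
    unfolding bij_betw_def
  proof
    show "inj_on \<phi> (carrier (mid E))"
    proof (rule inj_onI)
      fix d e assume de: "d \<in> carrier (mid E)" "e \<in> carrier (mid E)" and eq: "\<phi> d = \<phi> e"
      have p: "projection E d = projection E e" "A.coordinate d = A.coordinate e"
        using de arg_cong[OF eq, of "projection E'"] arg_cong[OF eq, of B.coordinate]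
        by (simp_all add: \<phi>_def)
      show "d = e"
        using A.decomposition[OF de(1)] A.decomposition[OF de(2)] by (simp only: p)
    qed
    show "\<phi> ` carrier (mid E) = carrier (mid E')"
    proof (intro equalityI subsetI)
      fix e assume e: "e \<in> carrier (mid E')"
      then have eq: "e = \<phi> (s (projection E' e) \<oplus>\<^bsub>mid E\<^esub> inclusion E (B.coordinate e))"
        using B.decomposition by (simp only: \<phi> B.projection_hom(1) B.coordinate_closed)
      then show "e \<in> \<phi> ` carrier (mid E)"
        by (rule image_eqI) (use e in simp)
    qed (use linear_mod_closed[OF linear] in auto)
  qed
  moreover have "\<phi> (inclusion E u) = inclusion E' u" if u: "u \<in> carrier V" for u
    using \<phi>[OF A.M.zero_closed u] u by simp
  moreover have "projection E' (\<phi> e) = projection E e" if "e \<in> carrier (mid E)" for e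
    using that by (simp add: \<phi>_def)
  ultimately show ?thesis
    using linear by (auto simp: extension_iso_def rb_isomorphism_def rb_morphism_def)
qed

lemma iso_transports_section:
  assumes "extension_with_section K lam L T V \<rho> S E s" "abelian_extension_of K lam L T V \<rho> S E'"
    and \<phi>: "rb_isomorphism K (mid E) (mid_op E) (mid E') (mid_op E') \<phi>"
    and incl: "\<And>u. u \<in> carrier V \<Longrightarrow> \<phi> (inclusion E u) = inclusion E' u"
    and proj: "\<And>e. e \<in> carrier (mid E) \<Longrightarrow> projection E' (\<phi> e) = projection E e"
    and ind: "E' \<in> extensions_inducing K lam L T V \<rho> S"
  shows "linear_section K L E' (\<lambda>x. \<phi> (s x))"
    and "x \<in> carrier L \<Longrightarrow> y \<in> carrier L \<Longrightarrow>
      bracket_defect L V E' (\<lambda>x. \<phi> (s x)) x y = bracket_defect L V E s x y"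
    and "x \<in> carrier L \<Longrightarrow> op_defect T V E' (\<lambda>x. \<phi> (s x)) x = op_defect T V E s x"
proof -
  interpret A: extension_with_section K lam L T V \<rho> S E s by fact
  interpret B: abelian_extension_of K lam L T V \<rho> S E' by fact
  have linear: "linear_mod K (mid E) (mid E') \<phi>"
    and bracket: "\<And>d e. d \<in> carrier (mid E) \<Longrightarrow> e \<in> carrier (mid E) \<Longrightarrow>
      \<phi> (bracket (mid E) d e) = bracket (mid E') (\<phi> d) (\<phi> e)"
    and op: "\<And>e. e \<in> carrier (mid E) \<Longrightarrow> \<phi> (mid_op E e) = mid_op E' (\<phi> e)"
    using \<phi> by (auto simp: rb_isomorphism_def rb_morphism_def)
  show sec: "linear_section K L E' (\<lambda>x. \<phi> (s x))"
    unfolding linear_section_def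
    using linear_mod_compose[OF A.section_linear linear] by (simp add: proj)
  interpret B': extension_with_section K lam L T V \<rho> S E' "\<lambda>x. \<phi> (s x)"
    by unfold_locales (fact ind sec)+
  {
    assume xy: "x \<in> carrier L" "y \<in> carrier L"
    show "bracket_defect L V E' (\<lambda>x. \<phi> (s x)) x y = bracket_defect L V E s x y"
      using arg_cong[OF A.bracket_section[OF xy], of \<phi>] xy
      by (intro B'.bracket_defect_eqI) (simp_all add: bracket linear_mod_add[OF linear] incl)
  next
    assume x: "x \<in> carrier L"
    show "op_defect T V E' (\<lambda>x. \<phi> (s x)) x = op_defect T V E s x"
      using arg_cong[OF A.op_section[OF x], of \<phi>] x
      by (intro B'.op_defect_eqI) (simp_all add: op linear_mod_add[OF linear] incl)
  }
qed

lemma (in rb_representation) cohomologous_cong: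
  assumes "\<And>x y. x \<in> carrier L \<Longrightarrow> y \<in> carrier L \<Longrightarrow> F1 x y = F2 x y" "\<And>x. x \<in> carrier L \<Longrightarrow> G1 x = G2 x"
  shows "cohomologous F1 G1 F G \<longleftrightarrow> cohomologous F2 G2 F G"
  using assms by (simp add: cohomologous_def)

text \<open>If the cocycles differ by the coboundary of \<open>h\<close>, shifting the first section by \<open>h\<close> makes the defects
  equal.\<close>

lemma (in rb_representation) extension_iso_iff_cohomologous:
  assumes "extension_with_section K lam L T V \<rho> S E s" "extension_with_section K lam L T V \<rho> S E' s'"
  shows "extension_iso K V E E' \<longleftrightarrow>
    cohomologous (bracket_defect L V E s) (op_defect T V E s) (bracket_defect L V E' s') (op_defect T V E' s')"
proof -
  interpret A: extension_with_section K lam L T V \<rho> S E s by fact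
  interpret B: extension_with_section K lam L T V \<rho> S E' s' by fact
  show ?thesis
  proof
    assume "extension_iso K V E E'"
    then obtain \<phi> where \<phi>: "rb_isomorphism K (mid E) (mid_op E) (mid E') (mid_op E') \<phi>"
        "\<And>u. u \<in> carrier V \<Longrightarrow> \<phi> (inclusion E u) = inclusion E' u"
        "\<And>e. e \<in> carrier (mid E) \<Longrightarrow> projection E' (\<phi> e) = projection E e"
      by (auto simp: extension_iso_def)
    have transport: "linear_section K L E' (\<lambda>x. \<phi> (s x))"
      "\<And>x y. x \<in> carrier L \<Longrightarrow> y \<in> carrier L \<Longrightarrow>
        bracket_defect L V E' (\<lambda>x. \<phi> (s x)) x y = bracket_defect L V E s x y"
      "\<And>x. x \<in> carrier L \<Longrightarrow> op_defect T V E' (\<lambda>x. \<phi> (s x)) x = op_defect T V E s x"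
      by (rule iso_transports_section[OF assms(1) B.abelian_extension_of_axioms \<phi>(1)];
          simp add: \<phi>(2,3) B.inducing)+
    interpret B': extension_with_section K lam L T V \<rho> S E' "\<lambda>x. \<phi> (s x)"
      by (intro extension_with_section.intro extension_with_section_axioms.intro
          B.abelian_extension_of_axioms B.inducing transport(1))
    show "cohomologous (bracket_defect L V E s) (op_defect T V E s)
        (bracket_defect L V E' s') (op_defect T V E' s')"
      using B'.sections_cohomologous[OF B.is_section] cohomologous_cong[OF transport(2,3)] by simp
  next
    assume "cohomologous (bracket_defect L V E s) (op_defect T V E s)
        (bracket_defect L V E' s') (op_defect T V E' s')"
    then obtain h where h: "linear_mod K L V h"
      and F': "\<And>x y. x \<in> carrier L \<Longrightarrow> y \<in> carrier L \<Longrightarrow>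
        bracket_defect L V E' s' x y = coboundary_bracket h x y \<oplus>\<^bsub>V\<^esub> bracket_defect L V E s x y"
      and G': "\<And>x. x \<in> carrier L \<Longrightarrow> op_defect T V E' s' x = coboundary_op h x \<oplus>\<^bsub>V\<^esub> op_defect T V E s x"
      by (auto simp: cohomologous_def)
    note shift = A.shifted_section[OF h]
    have "extension_with_section K lam L T V \<rho> S E (\<lambda>x. s x \<oplus>\<^bsub>mid E\<^esub> inclusion E (h x))"
      by unfold_locales (fact A.inducing shift(1))+
    then show "extension_iso K V E E'"
      by (rule extension_iso_if_equal_defects[OF _ assms(2)]) (simp_all add: shift F' G')
  qed
qed

section \<open>The extension of a cocycle\<close>

text \<open>The algebra \<open>L \<oplus> V\<close> with the bracket and operator that \<open>bracket_decomposed\<close> and \<open>op_decomposed\<close> force,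
  transported along \<open>emb\<close> to the type in which extensions are sought.\<close>

definition extension_of_pair where
  "extension_of_pair L T V \<rho> S emb F G =
    (let dec = inv_into (carrier L \<times> carrier V) emb in
     \<lparr>mid = \<lparr>carrier = emb ` (carrier L \<times> carrier V), monoid.mult = undefined, one = undefined,
        zero = emb (\<zero>\<^bsub>L\<^esub>, \<zero>\<^bsub>V\<^esub>),
        add = (\<lambda>d e. case (dec d, dec e) of ((x, u), (y, v)) \<Rightarrow> emb (x \<oplus>\<^bsub>L\<^esub> y, u \<oplus>\<^bsub>V\<^esub> v)),
        smult = (\<lambda>a e. case dec e of (x, u) \<Rightarrow> emb (a \<odot>\<^bsub>L\<^esub> x, a \<odot>\<^bsub>V\<^esub> u)),
        bracket = (\<lambda>d e. case (dec d, dec e) of ((x, u), (y, v)) \<Rightarrow>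
          emb (bracket L x y, F x y \<oplus>\<^bsub>V\<^esub> \<rho> x v \<ominus>\<^bsub>V\<^esub> \<rho> y u))\<rparr>,
      mid_op = (\<lambda>e. case dec e of (x, u) \<Rightarrow> emb (T x, G x \<oplus>\<^bsub>V\<^esub> S u)),
      inclusion = (\<lambda>u. emb (\<zero>\<^bsub>L\<^esub>, u)),
      projection = (\<lambda>e. fst (dec e))\<rparr>)"

locale extension_of_cocycle = rb_representation K lam L T V \<rho> S
  for K (structure) and lam and L (structure) and T and V (structure) and \<rho> and S +
  fixes emb F G
  assumes emb: "inj_on emb (carrier L \<times> carrier V)"
    and cocycle: "cocycle_pair F G"
begin

abbreviation "E \<equiv> extension_of_pair L T V \<rho> S emb F G"

lemma F: "alternating_bilinear K L V F" and G: "linear_mod K L V G"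
  using cocycle by (auto simp: cocycle_pair_def)

lemmas F_hom [simp] =
  alternating_bilinear_hom[OF F] alternating_bilinear_linear(3)[OF F]
  linear_mod_hom(4-)[OF module_L module_V alternating_bilinear_linear(1)[OF F]]
  linear_mod_hom(4-)[OF module_L module_V alternating_bilinear_linear(2)[OF F]]

lemmas G_hom [simp] = linear_mod_hom(1-3)[OF G] linear_mod_hom(4-)[OF module_L module_V G]

lemma dec: "x \<in> carrier L \<Longrightarrow> u \<in> carrier V \<Longrightarrow> inv_into (carrier L \<times> carrier V) emb (emb (x, u)) = (x, u)"
  using emb by simp

lemma emb_eq_iff [simp]:
  "x \<in> carrier L \<Longrightarrow> u \<in> carrier V \<Longrightarrow> y \<in> carrier L \<Longrightarrow> v \<in> carrier V \<Longrightarrow>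
    emb (x, u) = emb (y, v) \<longleftrightarrow> x = y \<and> u = v"
  using emb by (auto simp: inj_on_def)

lemma carrier_E: "carrier (mid E) = emb ` (carrier L \<times> carrier V)"
  by (simp add: extension_of_pair_def Let_def)

lemma emb_closed [simp]: "x \<in> carrier L \<Longrightarrow> u \<in> carrier V \<Longrightarrow> emb (x, u) \<in> carrier (mid E)"
  by (simp add: carrier_E)

lemma carrier_E_cases:
  assumes "e \<in> carrier (mid E)"
  obtains x u where "x \<in> carrier L" "u \<in> carrier V" "e = emb (x, u)"
  using assms by (auto simp: carrier_E)

lemma operations [simp]:
  "\<zero>\<^bsub>mid E\<^esub> = emb (\<zero>\<^bsub>L\<^esub>, \<zero>\<^bsub>V\<^esub>)"
  "inclusion E w = emb (\<zero>\<^bsub>L\<^esub>, w)"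
  "x \<in> carrier L \<Longrightarrow> u \<in> carrier V \<Longrightarrow> y \<in> carrier L \<Longrightarrow> v \<in> carrier V \<Longrightarrow>
    emb (x, u) \<oplus>\<^bsub>mid E\<^esub> emb (y, v) = emb (x \<oplus>\<^bsub>L\<^esub> y, u \<oplus>\<^bsub>V\<^esub> v)"
  "x \<in> carrier L \<Longrightarrow> u \<in> carrier V \<Longrightarrow> a \<odot>\<^bsub>mid E\<^esub> emb (x, u) = emb (a \<odot>\<^bsub>L\<^esub> x, a \<odot>\<^bsub>V\<^esub> u)"
  "x \<in> carrier L \<Longrightarrow> u \<in> carrier V \<Longrightarrow> y \<in> carrier L \<Longrightarrow> v \<in> carrier V \<Longrightarrow>
    bracket (mid E) (emb (x, u)) (emb (y, v)) = emb (bracket L x y, F x y \<oplus>\<^bsub>V\<^esub> \<rho> x v \<ominus>\<^bsub>V\<^esub> \<rho> y u)"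
  "x \<in> carrier L \<Longrightarrow> u \<in> carrier V \<Longrightarrow> mid_op E (emb (x, u)) = emb (T x, G x \<oplus>\<^bsub>V\<^esub> S u)"
  "x \<in> carrier L \<Longrightarrow> u \<in> carrier V \<Longrightarrow> projection E (emb (x, u)) = x"
  by (simp_all add: extension_of_pair_def Let_def dec)

lemma module_E: "module K (mid E)"
proof (rule moduleI)
  show "cring K" ..
  show "abelian_group (mid E)"
  proof (rule abelian_groupI)
    fix e assume "e \<in> carrier (mid E)"
    then obtain x u where e: "x \<in> carrier L" "u \<in> carrier V" "e = emb (x, u)"
      by (rule carrier_E_cases)
    then have "emb (\<ominus>\<^bsub>L\<^esub> x, \<ominus>\<^bsub>V\<^esub> u) \<oplus>\<^bsub>mid E\<^esub> e = \<zero>\<^bsub>mid E\<^esub>"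
      by (simp add: M.l_neg V.l_neg)
    then show "\<exists>d\<in>carrier (mid E). d \<oplus>\<^bsub>mid E\<^esub> e = \<zero>\<^bsub>mid E\<^esub>"
      using e by (intro bexI[of _ "emb (\<ominus>\<^bsub>L\<^esub> x, \<ominus>\<^bsub>V\<^esub> u)"]) simp_all
  qed (auto elim!: carrier_E_cases simp: M.a_ac V.a_ac)
qed (auto elim!: carrier_E_cases simp: smult_l_distr smult_r_distr smult_assoc1
      V.smult_l_distr V.smult_r_distr V.smult_assoc1)

lemma emb_cong: "x = y \<Longrightarrow> u = v \<Longrightarrow> emb (x, u) = emb (y, v)"
  by simp

text \<open>In the Jacobi identity the terms with two actions cancel because \<open>\<rho>\<close> is an action; the remaining
  \<open>V\<close>-component \<open>?J\<close> vanishes by the first cocycle equation.\<close>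

lemma lie_algebra_E: "lie_algebra K (mid E)"
proof (intro lie_algebra.intro lie_algebra_axioms.intro field_axioms module_E)
  fix e assume "e \<in> carrier (mid E)"
  then obtain y v where e: "y \<in> carrier L" "v \<in> carrier V" "e = emb (y, v)"
    by (rule carrier_E_cases)
  show "linear_mod K (mid E) (mid E) (\<lambda>d. bracket (mid E) d e)"
    unfolding linear_mod_def using e
    by (auto elim!: carrier_E_cases intro!: emb_cong simp: V.smult_r_distr V.smult_minus_distr)
      (rule V.eq_if_same_coefficients, (rule V.represents_intros | simp)+)
  show "linear_mod K (mid E) (mid E) (bracket (mid E) e)"
    unfolding linear_mod_def using e
    by (auto elim!: carrier_E_cases intro!: emb_cong simp: V.smult_r_distr V.smult_minus_distr)
      (rule V.eq_if_same_coefficients, (rule V.represents_intros | simp)+)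
  show "bracket (mid E) e e = \<zero>\<^bsub>mid E\<^esub>"
    using e by (simp add: bracket_alternating V.minus_eq_zero_iff)
next
  fix d e f assume def: "d \<in> carrier (mid E)" "e \<in> carrier (mid E)" "f \<in> carrier (mid E)"
  obtain x u y v z w where x: "x \<in> carrier L" "u \<in> carrier V" "d = emb (x, u)"
      and y: "y \<in> carrier L" "v \<in> carrier V" "e = emb (y, v)"
      and z: "z \<in> carrier L" "w \<in> carrier V" "f = emb (z, w)"
    using def by (auto elim!: carrier_E_cases)
  let ?J = "\<rho> x (F y z) \<oplus>\<^bsub>V\<^esub> \<rho> y (F z x) \<oplus>\<^bsub>V\<^esub> \<rho> z (F x y)
    \<oplus>\<^bsub>V\<^esub> F x (bracket L y z) \<oplus>\<^bsub>V\<^esub> F y (bracket L z x) \<oplus>\<^bsub>V\<^esub> F z (bracket L x y)"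
  let ?j = "bracket L x (bracket L y z) \<oplus>\<^bsub>L\<^esub> bracket L y (bracket L z x) \<oplus>\<^bsub>L\<^esub> bracket L z (bracket L x y)"
  have "bracket (mid E) d (bracket (mid E) e f) \<oplus>\<^bsub>mid E\<^esub> bracket (mid E) e (bracket (mid E) f d)
      \<oplus>\<^bsub>mid E\<^esub> bracket (mid E) f (bracket (mid E) d e) = emb (?j, ?J)"
    using x(1,2) y(1,2) z(1,2) unfolding x(3) y(3) z(3)
    by (simp add: action_bracket)
      (rule V.eq_if_same_coefficients, (rule V.represents_intros | simp)+)
  also have "\<dots> = \<zero>\<^bsub>mid E\<^esub>"
    using x y z jacobi cocycle by (simp add: cocycle_pair_def)
  finally show "bracket (mid E) d (bracket (mid E) e f) \<oplus>\<^bsub>mid E\<^esub> bracket (mid E) e (bracket (mid E) f d)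
      \<oplus>\<^bsub>mid E\<^esub> bracket (mid E) f (bracket (mid E) d e) = \<zero>\<^bsub>mid E\<^esub>" .
qed

text \<open>The second cocycle equation accounts for the terms free of \<open>u\<close> and \<open>v\<close>, the compatibility of \<open>S\<close> with
  the action for the others.\<close>

lemma rota_baxter_E: "rota_baxter_lie K lam (mid E) (mid_op E)"
proof (intro rota_baxter_lie.intro rota_baxter_lie_axioms.intro lie_algebra_E weight_closed)
  show "linear_mod K (mid E) (mid E) (mid_op E)"
    unfolding linear_mod_def
    by (auto elim!: carrier_E_cases simp: V.smult_r_distr V.a_ac)
  fix d e assume de: "d \<in> carrier (mid E)" "e \<in> carrier (mid E)"
  obtain x u y v where x: "x \<in> carrier L" "u \<in> carrier V" "d = emb (x, u)"
      and y: "y \<in> carrier L" "v \<in> carrier V" "e = emb (y, v)"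
    using de by (auto elim!: carrier_E_cases)
  let ?A = "F (T x) (T y) \<oplus>\<^bsub>V\<^esub> \<rho> (T x) (G y) \<ominus>\<^bsub>V\<^esub> \<rho> (T y) (G x)"
  let ?W = "F (T x) y \<oplus>\<^bsub>V\<^esub> F x (T y) \<oplus>\<^bsub>V\<^esub> lam \<odot>\<^bsub>V\<^esub> F x y \<oplus>\<^bsub>V\<^esub> \<rho> x (G y) \<ominus>\<^bsub>V\<^esub> \<rho> y (G x)"
  let ?P = "\<lambda>x v. \<rho> (T x) v \<oplus>\<^bsub>V\<^esub> \<rho> x (S v) \<oplus>\<^bsub>V\<^esub> lam \<odot>\<^bsub>V\<^esub> \<rho> x v"
  have "bracket (mid E) (mid_op E d) (mid_op E e)
      = emb (bracket L (T x) (T y), ?A \<oplus>\<^bsub>V\<^esub> \<rho> (T x) (S v) \<ominus>\<^bsub>V\<^esub> \<rho> (T y) (S u))"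
    using x(1,2) y(1,2) unfolding x(3) y(3)
    by simp (rule V.eq_if_same_coefficients, (rule V.represents_intros | simp)+)
  also have "\<dots> = emb (T (deformed_bracket lam L T x y),
      S ?W \<oplus>\<^bsub>V\<^esub> G (deformed_bracket lam L T x y) \<oplus>\<^bsub>V\<^esub> S (?P x v) \<ominus>\<^bsub>V\<^esub> S (?P y u))"
  proof -
    have "?A = S ?W \<oplus>\<^bsub>V\<^esub> G (deformed_bracket lam L T x y)"
      using cocycle x(1) y(1) unfolding cocycle_pair_def by blast
    then show ?thesis
      by (simp only: rep_rota_baxter[OF x(1) y(2)] rep_rota_baxter[OF y(1) x(2)] rota_baxter[OF x(1) y(1)])
  qed
  also have "\<dots> = mid_op E (deformed_bracket lam (mid E) (mid_op E) d e)"
    using x(1,2) y(1,2) weight_closed unfolding x(3) y(3) deformed_bracket_def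
    by (simp add: V.smult_r_distr V.smult_minus_distr)
      (rule V.eq_if_same_coefficients, (rule V.represents_intros | simp)+)
  finally show "bracket (mid E) (mid_op E d) (mid_op E e) =
      mid_op E (deformed_bracket lam (mid E) (mid_op E) d e)" .
qed

lemma abelian_extension_E: "abelian_extension K lam L T V S E"
proof -
  have "rb_morphism K (abelian_lie V) S (mid E) (mid_op E) (inclusion E)"
    using V.minus_eq_zero_iff[OF V.zero_closed V.zero_closed]
    by (auto simp: rb_morphism_def linear_mod_def abelian_lie_def)
  moreover have "rb_morphism K (mid E) (mid_op E) L T (projection E)"
    by (auto simp: rb_morphism_def linear_mod_def elim!: carrier_E_cases)
  moreover have "inclusion E ` carrier V = {e \<in> carrier (mid E). projection E e = \<zero>\<^bsub>L\<^esub>}"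
    by (auto elim!: carrier_E_cases)
  moreover have "projection E ` carrier (mid E) = carrier L"
  proof -
    have "x \<in> projection E ` carrier (mid E)" if "x \<in> carrier L" for x
      using that by (intro image_eqI[of _ _ "emb (x, \<zero>\<^bsub>V\<^esub>)"]) simp_all
    then show ?thesis
      by (auto elim!: carrier_E_cases)
  qed
  moreover have "inj_on (inclusion E) (carrier V)"
    by (auto simp: inj_on_def)
  ultimately show ?thesis
    using rota_baxter_E by (simp add: abelian_extension_def)
qed

lemma extension_with_section_E: "extension_with_section K lam L T V \<rho> S E (\<lambda>x. emb (x, \<zero>\<^bsub>V\<^esub>))"
proof -
  interpret E: abelian_extension_of K lam L T V \<rho> S E
    by unfold_locales (rule abelian_extension_E)
  have "E \<in> extensions_inducing K lam L T V \<rho> S"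
    unfolding E.inducing_iff by (auto elim!: carrier_E_cases simp: V.minus_eq)
  moreover have "linear_section K L E (\<lambda>x. emb (x, \<zero>\<^bsub>V\<^esub>))"
    by (auto simp: linear_section_def linear_mod_def)
  ultimately show ?thesis
    by (intro extension_with_section.intro extension_with_section_axioms.intro E.abelian_extension_of_axioms)
qed

lemma defects_E:
  shows "x \<in> carrier L \<Longrightarrow> y \<in> carrier L \<Longrightarrow> bracket_defect L V E (\<lambda>x. emb (x, \<zero>\<^bsub>V\<^esub>)) x y = F x y"
    and "x \<in> carrier L \<Longrightarrow> op_defect T V E (\<lambda>x. emb (x, \<zero>\<^bsub>V\<^esub>)) x = G x"
proof -
  interpret E: extension_with_section K lam L T V \<rho> S E "\<lambda>x. emb (x, \<zero>\<^bsub>V\<^esub>)"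
    by (rule extension_with_section_E)
  show "x \<in> carrier L \<Longrightarrow> y \<in> carrier L \<Longrightarrow> bracket_defect L V E (\<lambda>x. emb (x, \<zero>\<^bsub>V\<^esub>)) x y = F x y"
    by (rule E.bracket_defect_eqI) (simp_all add: V.minus_eq)
  show "x \<in> carrier L \<Longrightarrow> op_defect T V E (\<lambda>x. emb (x, \<zero>\<^bsub>V\<^esub>)) x = G x"
    by (rule E.op_defect_eqI) simp_all
qed

end

section \<open>Classification of abelian extensions\<close>

text \<open>The relation is defined by \<open>c\<close> itself, so the image of a class under \<open>c\<close> is a singleton and determines the
  class.\<close>

lemma bij_betw_quotient:
  "bij_betw (\<lambda>X. the_elem (c ` X)) (A // {(x, y). x \<in> A \<and> y \<in> A \<and> c x = c y}) (c ` A)"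
proof -
  let ?r = "{(x, y). x \<in> A \<and> y \<in> A \<and> c x = c y}"
  have "c ` (?r `` {x}) = {c x}" if "x \<in> A" for x
    using that by auto
  then have class_image: "the_elem (c ` (?r `` {x})) = c x" if "x \<in> A" for x
    using that by simp
  have quotient: "A // ?r = (\<lambda>x. ?r `` {x}) ` A"
    unfolding quotient_def by blast
  show ?thesis
    unfolding bij_betw_def quotient
  proof
    show "inj_on (\<lambda>X. the_elem (c ` X)) ((\<lambda>x. ?r `` {x}) ` A)"
    proof (rule inj_onI, elim imageE)
      fix X Y x y
      assume "the_elem (c ` X) = the_elem (c ` Y)" "X = ?r `` {x}" "Y = ?r `` {y}" "x \<in> A" "y \<in> A"
      then have "x \<in> A" "y \<in> A" "c x = c y"
        by (simp_all only: class_image)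
      then show "X = Y"
        unfolding \<open>X = _\<close> \<open>Y = _\<close> by auto
    qed
    show "(\<lambda>X. the_elem (c ` X)) ` (\<lambda>x. ?r `` {x}) ` A = c ` A"
      unfolding image_image by (rule image_cong[OF refl class_image])
  qed
qed

theorem theorem4p3:
  fixes K :: "'k ring" and lam :: 'k
    and L :: "('k, 'a) lie_alg" and T :: "'a \<Rightarrow> 'a"
    and V :: "('k, 'v) module" and \<rho> :: "'a \<Rightarrow> 'v \<Rightarrow> 'v" and S :: "'v \<Rightarrow> 'v"
    and emb :: "'a \<times> 'v \<Rightarrow> 'e"
  assumes "field_char_zero K"
    and "rota_baxter_lie K lam L T"
    and "rb_representation K lam L T V \<rho> S"
    and "inj_on emb (carrier L \<times> carrier V)"
  shows "\<exists>\<Theta>. bij_betw \<Theta>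
           (Ext K lam L T V \<rho> S :: ('k, 'a, 'v, 'e) extension set set)
           (carrier (rb_cohomology K lam L T V \<rho> S 2))"
proof -
  interpret rb_representation K lam L T V \<rho> S by fact
  define A where "A = (extensions_inducing K lam L T V \<rho> S :: ('k, 'a, 'v, 'e) extension set)"
  define sec where "sec E = (SOME s. linear_section K L E s)" for E :: "('k, 'a, 'v, 'e) extension"
  define z where "z E = cochain_of_pair L (bracket_defect L V E (sec E)) (op_defect T V E (sec E))"
    for E :: "('k, 'a, 'v, 'e) extension"
  have ext: "extension_with_section K lam L T V \<rho> S E (sec E)" if E: "E \<in> A" for E
  proof -
    interpret E: abelian_extension_of K lam L T V \<rho> S E
      using E by unfold_locales (simp add: A_def extensions_inducing_def)
    have "linear_section K L E (sec E)"
      unfolding sec_def using E.section_exists by (rule someI_ex)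
    then show ?thesis
      using E by (intro extension_with_section.intro extension_with_section_axioms.intro
          E.abelian_extension_of_axioms) (simp_all add: A_def)
  qed
  note cocycle = extension_with_section.defects_cocycle[OF ext]
  have iso_iff: "extension_iso K V E E' \<longleftrightarrow> cohomology_class (z E) = cohomology_class (z E')"
    if "E \<in> A" "E' \<in> A" for E E'
    using that extension_iso_iff_cohomologous[OF ext ext] cohomology_class_eq_iff[OF cocycle cocycle]
    by (simp add: z_def)
  have "(\<lambda>E. cohomology_class (z E)) ` A = carrier (rb_cohomology K lam L T V \<rho> S 2)"
  proof -
    have "cohomology_class ` z ` A = cohomology_class ` rb_cocycles K lam L T V \<rho> S 2"
    proof (intro equalityI subsetI)
      fix X assume "X \<in> cohomology_class ` z ` A"
      then show "X \<in> cohomology_class ` rb_cocycles K lam L T V \<rho> S 2"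
        using cocycle cocycle_iff by (auto simp: z_def)
    next
      fix X assume "X \<in> cohomology_class ` rb_cocycles K lam L T V \<rho> S 2"
      then obtain F G where FG: "cocycle_pair F G" and X: "X = cohomology_class (cochain_of_pair L F G)"
        by (auto elim: cocycle_cases)
      interpret EC: extension_of_cocycle K lam L T V \<rho> S emb F G
        by unfold_locales (fact assms FG)+
      let ?E = "EC.E"
      have E: "?E \<in> A"
        using EC.extension_with_section_E by (simp add: A_def extension_with_section.inducing)
      have "cohomologous (bracket_defect L V ?E (\<lambda>x. emb (x, \<zero>\<^bsub>V\<^esub>))) (op_defect T V ?E (\<lambda>x. emb (x, \<zero>\<^bsub>V\<^esub>)))
          (bracket_defect L V ?E (sec ?E)) (op_defect T V ?E (sec ?E))"
        using ext[OF E, THEN extension_with_section.is_section]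
        by (rule extension_with_section.sections_cohomologous[OF EC.extension_with_section_E])
      then have "cohomologous F G (bracket_defect L V ?E (sec ?E)) (op_defect T V ?E (sec ?E))"
        using cohomologous_cong[OF EC.defects_E] by simp
      then have "X = cohomology_class (z ?E)"
        unfolding X z_def using cohomology_class_eq_iff[OF FG cocycle[OF E]] by simp
      then show "X \<in> cohomology_class ` z ` A"
        using E by blast
    qed
    then show ?thesis
      by (simp add: rb_cohomology_def carrier_FactGroup image_image)
  qed
  moreover have "Ext K lam L T V \<rho> S = A // {(E, E'). E \<in> A \<and> E' \<in> A \<and> cohomology_class (z E) = cohomology_class (z E')}"
    unfolding Ext_def A_def[symmetric] using iso_iff by (intro arg_cong[where f = "\<lambda>r. A // r"]) auto
  ultimately show ?thesis
    using bij_betw_quotient[of "\<lambda>E. cohomology_class (z E)" A] by metis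
qed

end
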